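(* Let the scalar field be $\mathbb{R}$ and let $Y$ be a Banach space such that both $Y$ and $Y^*$ are strictly convex. Then $\mathrm{INA}_\pi(c_0\widehat{\otimes}_\pi Y)=\mathrm{NA}_\pi(c_0\widehat{\otimes}_\pi Y)=\mathrm{FNA}_\pi(c_0\widehat{\otimes}_\pi Y)\subseteq c_0\otimes Y$ (the algebraic tensor product). In particular, if in addition $Y$ is infinite-dimensional, then $\mathrm{INA}_\pi(c_0\widehat{\otimes}_\pi Y)\neq c_0\widehat{\otimes}_\pi Y$.
   Context: $\mathrm{NA}_\pi$: tensors $u=\sum_n\lambda_n x_n\otimes y_n$ with $(x_n,y_n)\in B_X\times B_Y$, $\lambda_n\ge0$, $\sum_n\lambda_n=\|u\|_\pi$. $\mathrm{FNA}_\pi$: tensors admitting a finite representation $u=\sum_{k=1}^n x_k\otimes y_k$ with $\sum_k\|x_k\|\|y_k\|=\|u\|_\pi$. Definition: $u\in X\widehat{\otimes}_\pi Y$ is an integral projective norm-attaining tensor, written $u\in\mathrm{INA}_\pi(X\widehat{\otimes}_\pi Y)$, if there is a finite positive Borel measure $\mu$ on $B_X\times B_Y$ (norm topology) such that $\varphi:B_X\times B_Y\to X\widehat{\otimes}_\pi Y$, $\varphi(x,y)=x\otimes y$, is $\mu$-Bochner integrable, $u=\int_{B_X\times B_Y}x\otimes y\,d\mu(x,y)$ (Bochner integral) and $\|\mu\|=\|u\|_\pi$; then $u$ is said to be witnessed by $\mu$. *)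

theory Defs
  imports "HOL-Analysis.Analysis"
begin

typedef c0 = "{f :: nat \<Rightarrow>\<^sub>C real. (\<lambda>n. apply_bcontfun f n) \<longlonglongrightarrow> 0}"
  morphisms c0_rep Abs_c0
  by (rule exI[of _ 0]) simp

setup_lifting type_definition_c0

instantiation c0 :: real_vector
begin
lift_definition zero_c0 :: c0 is 0 by simp
lift_definition plus_c0 :: "c0 \<Rightarrow> c0 \<Rightarrow> c0" is "(+)"
  by (simp add: tendsto_add_zero)
lift_definition minus_c0 :: "c0 \<Rightarrow> c0 \<Rightarrow> c0" is "(-)"
  using tendsto_diff by fastforce
lift_definition uminus_c0 :: "c0 \<Rightarrow> c0" is uminus
  using tendsto_minus by fastforce
lift_definition scaleR_c0 :: "real \<Rightarrow> c0 \<Rightarrow> c0" is scaleR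
  using tendsto_mult_right_zero by fastforce
instance
  by standard (transfer; simp add: algebra_simps)+
end

instantiation c0 :: real_normed_vector
begin
lift_definition norm_c0 :: "c0 \<Rightarrow> real" is norm .
definition dist_c0 :: "c0 \<Rightarrow> c0 \<Rightarrow> real" where "dist_c0 x y = norm (x - y)"
definition sgn_c0 :: "c0 \<Rightarrow> c0" where "sgn_c0 x = x /\<^sub>R norm x"
definition uniformity_c0 :: "(c0 \<times> c0) filter" where
  "uniformity_c0 = (INF e\<in>{0<..}. principal {(x, y). dist x y < e})"
definition open_c0 :: "c0 set \<Rightarrow> bool" where
  "open_c0 U = (\<forall>x\<in>U. \<forall>\<^sub>F (x', y) in uniformity. x' = x \<longrightarrow> y \<in> U)"
instance
proof
  fix x y :: c0 and a :: real
  show "norm (x + y) \<le> norm x + norm y" by transfer (rule norm_triangle_ineq)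
  show "norm (a *\<^sub>R x) = \<bar>a\<bar> * norm x" by transfer simp
  show "(norm x = 0) = (x = 0)" by transfer simp
qed (simp_all add: dist_c0_def sgn_c0_def uniformity_c0_def open_c0_def)
end

definition strictly_convex :: "'a::real_normed_vector itself \<Rightarrow> bool" where
  "strictly_convex _ \<longleftrightarrow>
     (\<forall>x y :: 'a. norm x = 1 \<and> norm y = 1 \<and> x \<noteq> y \<longrightarrow> norm ((1/2) *\<^sub>R (x + y)) < 1)"

text \<open>The completed projective tensor product of X and Y is realised inside the dual of
  L(X, Y^*) (= bounded bilinear forms on X \<times> Y = (X \<otimes>_\<pi> Y)^*): it is the set of
  functionals having a representation as an absolutely convergent series of elementary
  tensors, equipped with the projective norm (infimum over such representations).\<close>

type_synonym ('a, 'b) ptensor = "('a \<Rightarrow>\<^sub>L ('b \<Rightarrow>\<^sub>L real)) \<Rightarrow>\<^sub>L real"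

definition tensor :: "'a::real_normed_vector \<Rightarrow> 'b::real_normed_vector \<Rightarrow> ('a, 'b) ptensor" where
  "tensor x y = Blinfun (\<lambda>T. blinfun_apply (blinfun_apply T x) y)"

definition proj_rep :: "('a::real_normed_vector, 'b::real_normed_vector) ptensor \<Rightarrow> (nat \<Rightarrow> 'a) \<Rightarrow> (nat \<Rightarrow> 'b) \<Rightarrow> bool" where
  "proj_rep u x y \<longleftrightarrow> summable (\<lambda>n. norm (x n) * norm (y n)) \<and> (\<lambda>n. tensor (x n) (y n)) sums u"

definition proj_space :: "('a::real_normed_vector, 'b::real_normed_vector) ptensor set" where
  "proj_space = {u. \<exists>x y. proj_rep u x y}"

definition pnorm :: "('a::real_normed_vector, 'b::real_normed_vector) ptensor \<Rightarrow> real" where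
  "pnorm u = Inf {\<Sum>n. norm (x n) * norm (y n) | x y. proj_rep u x y}"

definition alg_tensor :: "('a::real_normed_vector, 'b::real_normed_vector) ptensor set" where
  "alg_tensor = {u. \<exists>(n::nat) x y. u = (\<Sum>k<n. tensor (x k) (y k))}"

definition NA_pi :: "('a::real_normed_vector, 'b::real_normed_vector) ptensor set" where
  "NA_pi = {u \<in> proj_space. \<exists>(l::nat \<Rightarrow> real) x y.
      (\<forall>n. l n \<ge> 0 \<and> norm (x n) \<le> 1 \<and> norm (y n) \<le> 1) \<and> summable l \<and>
      (\<lambda>n. l n *\<^sub>R tensor (x n) (y n)) sums u \<and> suminf l = pnorm u}"

definition FNA_pi :: "('a::real_normed_vector, 'b::real_normed_vector) ptensor set" where
  "FNA_pi = {u \<in> proj_space. \<exists>(n::nat) x y. u = (\<Sum>k<n. tensor (x k) (y k)) \<and>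
      (\<Sum>k<n. norm (x k) * norm (y k)) = pnorm u}"

text \<open>Bochner integral with values in the projective tensor product (with respect to the
  projective norm); this is the library definition of has_bochner_integral without
  the separability restriction, with all norms taken to be the projective norm.\<close>

definition has_pbochner_integral ::
  "'x measure \<Rightarrow> ('x \<Rightarrow> ('a::real_normed_vector, 'b::real_normed_vector) ptensor) \<Rightarrow> ('a, 'b) ptensor \<Rightarrow> bool" where
  "has_pbochner_integral M f u \<longleftrightarrow>
     u \<in> proj_space \<and> f ` space M \<subseteq> proj_space \<and> f \<in> borel_measurable M \<and>
     (\<exists>s. (\<forall>i. Bochner_Integration.simple_bochner_integrable M (s i) \<and> s i ` space M \<subseteq> proj_space \<and>
               (\<lambda>z. pnorm (f z - s i z)) \<in> borel_measurable M) \<and>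
          (\<lambda>i. \<integral>\<^sup>+ z. ennreal (pnorm (f z - s i z)) \<partial>M) \<longlonglongrightarrow> 0 \<and>
          (\<lambda>i. pnorm (Bochner_Integration.simple_bochner_integral M (s i) - u)) \<longlonglongrightarrow> 0)"

definition INA_pi :: "('a::real_normed_vector, 'b::real_normed_vector) ptensor set" where
  "INA_pi = {u \<in> proj_space. \<exists>M :: ('a \<times> 'b) measure.
      space M = cball 0 1 \<times> cball 0 1 \<and>
      sets M = sets (restrict_space borel (cball (0::'a) 1 \<times> cball (0::'b) 1)) \<and>
      finite_measure M \<and>
      has_pbochner_integral M (\<lambda>(x, y). tensor x y) u \<and>
      measure M (space M) = pnorm u}"

end

theory Submission
  imports Defs
begin

text \<open>By the Hahn-Banach theorem there is an operator \<open>T\<close> from \<open>c0\<close> to the dual of \<open>Y\<close> with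
  \<open>norm T \<le> 1\<close> whose value at \<open>u\<close> is the projective norm of \<open>u\<close>. If \<open>u\<close> is represented by a measure
  (or a series) attaining this norm, then \<open>T x y = 1\<close> for almost all \<open>(x, y)\<close>. Where \<open>\<bar>x n\<bar> < 1\<close>, the
  point \<open>x\<close> can be moved in both directions along \<open>e n\<close> inside the unit ball, so strict convexity of
  the dual forces \<open>T (e n) = 0\<close>. Hence \<open>T\<close> depends on finitely many coordinates only, on which
  \<open>x\<close> takes the values \<open>\<plusminus>1\<close>, and \<open>T x\<close> takes finitely many values. Strict convexity of \<open>Y\<close> then leaves
  finitely many \<open>y\<close>; integrating \<open>x\<close> over the set belonging to each \<open>y\<close> yields a finite
  norm-attaining representation.\<close>

section \<open>The Hahn-Banach theorem\<close>

definition sublinear :: "('a::real_vector \<Rightarrow> real) \<Rightarrow> bool" where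
  "sublinear p \<longleftrightarrow> (\<forall>x y. p (x + y) \<le> p x + p y) \<and> (\<forall>t\<ge>0. \<forall>x. p (t *\<^sub>R x) = t * p x)"

lemma sublinear_add: "sublinear p \<Longrightarrow> p (x + y) \<le> p x + p y"
  by (simp add: sublinear_def)

lemma sublinear_scaleR: "sublinear p \<Longrightarrow> 0 \<le> t \<Longrightarrow> p (t *\<^sub>R x) = t * p x"
  by (simp add: sublinear_def)

lemma sublinear_0: "sublinear p \<Longrightarrow> p 0 = 0"
  using sublinear_scaleR[of p 0 0] by simp

lemma sublinear_minus: "sublinear p \<Longrightarrow> - p (- x) \<le> p x"
  using sublinear_add[of p x "- x"] sublinear_0[of p] by simp

text \<open>The upper half of positive homogeneity suffices: used with \<open>inverse t\<close> at
  the vector \<open>t *\<^sub>R x\<close>, it yields the lower half.\<close>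

lemma sublinearI:
  assumes add: "\<And>x y. p (x + y) \<le> p x + p y" and zero: "p 0 = 0"
    and scale: "\<And>t x. 0 < t \<Longrightarrow> p (t *\<^sub>R x) \<le> t * p x"
  shows "sublinear p"
proof -
  have "p (t *\<^sub>R x) = t * p x" if "t > 0" for t x
  proof (rule antisym[OF scale[OF that]])
    have "p x \<le> inverse t * p (t *\<^sub>R x)"
      using scale[of "inverse t" "t *\<^sub>R x"] that by simp
    then show "t * p x \<le> p (t *\<^sub>R x)"
      using that by (simp add: field_simps)
  qed
  then have "p (t *\<^sub>R x) = t * p x" if "t \<ge> 0" for t x
    using that zero by (cases "t = 0") auto
  with add show ?thesis by (simp add: sublinear_def)
qed

text \<open>\<open>r\<close> is the largest sublinear functional below \<open>q\<close> whose value
  at \<open>- y\<close> is at most \<open>- q y\<close>. Formed at a prescribed point, it fixes the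
  value there; formed from a minimal functional, it must return that functional, which forces
  additivity.\<close>

lemma sublinear_lower:
  fixes q :: "'a::real_vector \<Rightarrow> real" and y :: 'a
  assumes q: "sublinear q"
  defines "r \<equiv> \<lambda>x. INF t\<in>{0..}. q (x + t *\<^sub>R y) - t * q y"
  shows "sublinear r" "r \<le> q" "r (- y) \<le> - q y"
proof -
  have bdd: "bdd_below ((\<lambda>t. q (x + t *\<^sub>R y) - t * q y) ` {0..})" for x
  proof (rule bdd_belowI2[where m="- q (- x)"])
    fix t :: real assume "t \<in> {0..}"
    then show "- q (- x) \<le> q (x + t *\<^sub>R y) - t * q y"
      using sublinear_add[OF q, of "x + t *\<^sub>R y" "- x"] sublinear_scaleR[OF q, of t y] by simp
  qed
  have le: "r x \<le> q (x + t *\<^sub>R y) - t * q y" if "t \<ge> 0" for x t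
    unfolding r_def by (rule cINF_lower[OF bdd]) (use that in simp)
  have ge: "c \<le> r x" if "\<And>t. t \<ge> 0 \<Longrightarrow> c \<le> q (x + t *\<^sub>R y) - t * q y" for c x
    unfolding r_def by (rule cINF_greatest) (use that in auto)
  show "r \<le> q"
    using le[of 0] by (simp add: le_fun_def)
  show "r (- y) \<le> - q y"
    using le[of 1 "- y"] sublinear_0[OF q] by simp
  show "sublinear r"
  proof (rule sublinearI)
    fix x z
    have "r (x + z) - r x \<le> r z"
    proof (rule ge)
      fix s :: real assume s: "s \<ge> 0"
      have "r (x + z) - (q (z + s *\<^sub>R y) - s * q y) \<le> r x"
      proof (rule ge)
        fix t :: real assume t: "t \<ge> 0"
        \<comment> \<open>Parameters \<open>t\<close> for \<open>x\<close> and \<open>s\<close> for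
          \<open>z\<close> combine to the parameter \<open>t + s\<close> for
          \<open>x + z\<close>.\<close>
        have "r (x + z) \<le> q (x + z + (t + s) *\<^sub>R y) - (t + s) * q y"
          using le s t by simp
        also have "q (x + z + (t + s) *\<^sub>R y) \<le> q (x + t *\<^sub>R y) + q (z + s *\<^sub>R y)"
          using sublinear_add[OF q, of "x + t *\<^sub>R y" "z + s *\<^sub>R y"] by (simp add: algebra_simps)
        finally show "r (x + z) - (q (z + s *\<^sub>R y) - s * q y) \<le> q (x + t *\<^sub>R y) - t * q y"
          by (simp add: algebra_simps)
      qed
      then show "r (x + z) - r x \<le> q (z + s *\<^sub>R y) - s * q y" by simp
    qed
    then show "r (x + z) \<le> r x + r z" by simp
  next
    have "0 \<le> r 0"
      by (rule ge) (simp add: sublinear_scaleR[OF q])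
    then show "r 0 = 0"
      using le[of 0 0] sublinear_0[OF q] by simp
  next
    fix t :: real and x assume t: "0 < t"
    have "r (t *\<^sub>R x) / t \<le> r x"
    proof (rule ge)
      fix s :: real assume s: "s \<ge> 0"
      \<comment> \<open>Rescaling the parameter from \<open>s\<close> to \<open>t * s\<close>
        carries the infimum at \<open>x\<close> to the one at \<open>t *\<^sub>R x\<close>.\<close>
      have "r (t *\<^sub>R x) \<le> q (t *\<^sub>R x + (t * s) *\<^sub>R y) - (t * s) * q y"
        using le[of "t * s"] s t by simp
      also have "q (t *\<^sub>R x + (t * s) *\<^sub>R y) = t * q (x + s *\<^sub>R y)"
        using sublinear_scaleR[OF q, of t "x + s *\<^sub>R y"] t by (simp add: scaleR_add_right)
      finally show "r (t *\<^sub>R x) / t \<le> q (x + s *\<^sub>R y) - s * q y"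
        using t by (simp add: field_simps)
    qed
    then show "r (t *\<^sub>R x) \<le> t * r x" using t by (simp add: field_simps)
  qed
qed

text \<open>Zorn's lemma is applied downwards, to functionals on the whole space instead of partial
  extensions: a minimal sublinear functional is linear. Lowering \<open>p\<close> along
  \<open>u\<close> beforehand makes the result attain \<open>p u\<close> at
  \<open>u\<close>.\<close>

theorem hahn_banach_sublinear:
  fixes p :: "'a::real_vector \<Rightarrow> real"
  assumes p: "sublinear p"
  shows "\<exists>\<phi>. linear \<phi> \<and> (\<forall>x. \<phi> x \<le> p x) \<and> \<phi> u = p u"
proof -
  obtain p' where p': "sublinear p'" "p' \<le> p" "p' (- u) \<le> - p u"
    using sublinear_lower[OF p] by blast
  define A where "A = {q. sublinear q \<and> q \<le> p'}"
  have "\<exists>m\<in>A. \<forall>a\<in>A. m \<ge> a \<longrightarrow> a = m"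
  proof (rule predicate_Zorn)
    show "partial_order_on A (relation_of (\<ge>) A)"
      by (rule partial_order_on_relation_ofI) auto
    fix C assume C: "C \<in> Chains (relation_of (\<ge>) A)"
    have CA: "C \<subseteq> A" and tot: "\<And>q r. q \<in> C \<Longrightarrow> r \<in> C \<Longrightarrow> q \<le> r \<or> r \<le> q"
      using C by (auto simp: Chains_def relation_of_def)
    show "\<exists>v\<in>A. \<forall>a\<in>C. a \<ge> v"
    proof (cases "C = {}")
      case True
      then show ?thesis using p' by (auto simp: A_def)
    next
      case False
      \<comment> \<open>The pointwise infimum is the lower bound of the chain.\<close>
      define v where "v x = (INF q\<in>C. q x)" for x
      have sub: "sublinear q" "q x \<le> p' x" if "q \<in> C" for q x
        using that CA by (auto simp: A_def le_fun_def)
      have bdd: "bdd_below ((\<lambda>q. q x) ` C)" for x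
      proof (rule bdd_belowI2[where m="- p' (- x)"])
        fix q assume q: "q \<in> C"
        show "- p' (- x) \<le> q x"
          using sublinear_minus[OF sub(1)[OF q], of x] sub(2)[OF q, of "- x"] by simp
      qed
      have le: "v x \<le> q x" if "q \<in> C" for q x
        unfolding v_def by (rule cINF_lower[OF bdd that])
      have ge: "c \<le> v x" if "\<And>q. q \<in> C \<Longrightarrow> c \<le> q x" for c x
        unfolding v_def by (rule cINF_greatest[OF False that])
      have "sublinear v"
      proof (rule sublinearI)
        fix x y
        have "v (x + y) - v x \<le> v y"
        proof (rule ge)
          fix q assume q: "q \<in> C"
          have "v (x + y) - q y \<le> v x"
          proof (rule ge)
            fix r assume r: "r \<in> C"
            \<comment> \<open>Two members of a chain are comparable, so the smaller one can be used
              at both \<open>x\<close> and \<open>y\<close>.\<close>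
            have "v (x + y) \<le> r x + q y"
            proof (cases "q \<le> r")
              case True
              then show ?thesis
                using le[OF q, of "x + y"] sublinear_add[OF sub(1)[OF q], of x y]
                by (auto dest: le_funD[of _ _ x])
            next
              case False
              then have "r \<le> q" using tot q r by blast
              then show ?thesis
                using le[OF r, of "x + y"] sublinear_add[OF sub(1)[OF r], of x y]
                by (auto dest: le_funD[of _ _ y])
            qed
            then show "v (x + y) - q y \<le> r x" by simp
          qed
          then show "v (x + y) - v x \<le> q y" by simp
        qed
        then show "v (x + y) \<le> v x + v y" by simp
      next
        show "v 0 = 0"
          using False by (simp add: v_def sublinear_0[OF sub(1)])
      next
        fix t :: real and x assume t: "0 < t"
        have "v (t *\<^sub>R x) / t \<le> v x"
        proof (rule ge)
          fix q assume q: "q \<in> C"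
          show "v (t *\<^sub>R x) / t \<le> q x"
            using le[OF q, of "t *\<^sub>R x"] sublinear_scaleR[OF sub(1)[OF q], of t x] t
            by (simp add: field_simps)
        qed
        then show "v (t *\<^sub>R x) \<le> t * v x" using t by (simp add: field_simps)
      qed
      moreover have "v \<le> p'"
      proof (rule le_funI)
      fix x
      obtain q where "q \<in> C" using False by blast
      then show "v x \<le> p' x" using le[of q x] sub(2)[of q x] by simp
    qed
      ultimately show ?thesis
        using le by (auto simp: A_def le_fun_def)
    qed
  qed
  then obtain m where mA: "m \<in> A" and max: "\<And>a. a \<in> A \<Longrightarrow> a \<le> m \<Longrightarrow> a = m"
    by blast
  have m: "sublinear m" "m \<le> p'" using mA by (auto simp: A_def)
  have min: "q = m" if "sublinear q" "q \<le> m" for q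
    using max[of q] that order_trans[OF that(2) m(2)] by (simp add: A_def)
  have "m (x + y) = m x + m y" for x y
  proof -
    \<comment> \<open>By minimality, lowering \<open>m\<close> along \<open>y\<close> changes
      nothing. The parameter 1 in the infimum then gives
      \<open>m x + m y \<le> m (x + y)\<close>.\<close>
    define r where "r = (\<lambda>x. INF t\<in>{0..}. m (x + t *\<^sub>R y) - t * m y)"
    have "sublinear r" "r \<le> m"
      unfolding r_def by (rule sublinear_lower[OF m(1)])+
    then have "r = m" by (rule min)
    have "r x' + m y \<le> m (x' + y)" for x'
    proof -
      have "bdd_below ((\<lambda>t. m (x' + t *\<^sub>R y) - t * m y) ` {0..})"
      proof (rule bdd_belowI2[where m="- m (- x')"])
        fix t :: real assume "t \<in> {0..}"
        then show "- m (- x') \<le> m (x' + t *\<^sub>R y) - t * m y"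
          using sublinear_add[OF m(1), of "x' + t *\<^sub>R y" "- x'"] sublinear_scaleR[OF m(1), of t y]
          by simp
      qed
      from cINF_lower[OF this, of 1] show ?thesis by (simp add: r_def)
    qed
    then show ?thesis
      using sublinear_add[OF m(1), of x y] \<open>r = m\<close> by (simp add: antisym)
  qed
  moreover have "m (t *\<^sub>R x) = t * m x" for t x
  proof (cases "t \<ge> 0")
    case True
    then show ?thesis by (rule sublinear_scaleR[OF m(1)])
  next
    case False
    have "m (t *\<^sub>R x) + m ((- t) *\<^sub>R x) = 0"
      using calculation[of "t *\<^sub>R x" "(- t) *\<^sub>R x"] sublinear_0[OF m(1)] by simp
    then show ?thesis
      using sublinear_scaleR[OF m(1), of "- t" x] False by simp
  qed
  ultimately have lin: "linear m" by (auto intro: linearI)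
  have "m x \<le> p x" for x
    by (rule order_trans[OF le_funD[OF m(2)] le_funD[OF p'(2)]])
  \<comment> \<open>The value at \<open>- u\<close> bounds \<open>m u\<close> from below:
    \<open>- m u = m (- u) \<le> p' (- u) \<le> - p u\<close>.\<close>
  moreover have "- m u \<le> - p u"
    using le_funD[OF m(2), of "- u"] p'(3) linear_neg[OF lin, of u] by simp
  ultimately show ?thesis using lin by (intro exI[of _ m]) (auto intro: antisym)
qed

corollary norming_functional:
  fixes y :: "'a::real_normed_vector"
  obtains f :: "'a \<Rightarrow>\<^sub>L real" where "norm f \<le> 1" "f y = norm y"
proof -
  have "sublinear (norm :: 'a \<Rightarrow> real)"
    by (rule sublinearI) (auto simp: norm_triangle_ineq)
  then obtain \<phi> where \<phi>: "linear \<phi>" "\<And>x. \<phi> x \<le> norm x" "\<phi> y = norm y"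
    using hahn_banach_sublinear[of norm y] by blast
  have abs: "\<bar>\<phi> x\<bar> \<le> norm x" for x
    using \<phi>(2)[of x] \<phi>(2)[of "- x"] linear_neg[OF \<phi>(1), of x] by simp
  have bl: "bounded_linear \<phi>"
    using \<phi>(1) abs by (auto simp: bounded_linear_def bounded_linear_axioms_def intro!: exI[of _ 1])
  show thesis
  proof (rule that[of "Blinfun \<phi>"])
    show "norm (Blinfun \<phi>) \<le> 1"
      by (rule norm_blinfun_bound) (auto simp: bounded_linear_Blinfun_apply[OF bl] abs)
  qed (simp add: bounded_linear_Blinfun_apply[OF bl] \<phi>(3))
qed

section \<open>The projective norm\<close>

lemma tensor_apply [simp]:
  fixes x :: "'a::real_normed_vector" and y :: "'b::real_normed_vector"
  shows "blinfun_apply (tensor x y) T = blinfun_apply (blinfun_apply T x) y"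
proof -
  have "bounded_linear (\<lambda>T :: 'a \<Rightarrow>\<^sub>L 'b \<Rightarrow>\<^sub>L real. blinfun_apply (blinfun_apply T x) y)"
    by (rule bounded_linear_compose[OF blinfun.bounded_linear_left blinfun.bounded_linear_left])
  then show ?thesis by (simp add: tensor_def bounded_linear_Blinfun_apply)
qed

lemma abs_blinfun_apply2_le:
  fixes T :: "'a::real_normed_vector \<Rightarrow>\<^sub>L ('b::real_normed_vector \<Rightarrow>\<^sub>L real)"
  shows "\<bar>T x y\<bar> \<le> norm T * (norm x * norm y)"
proof -
  have "\<bar>T x y\<bar> \<le> norm (T x) * norm y" using norm_blinfun[of "T x" y] by simp
  also have "\<dots> \<le> norm T * norm x * norm y" by (intro mult_right_mono norm_blinfun) auto
  finally show ?thesis by (simp add: mult.assoc)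
qed

lemma norm_tensor_le: "norm (tensor x y) \<le> norm x * norm y"
  by (rule norm_blinfun_bound)
    (use abs_blinfun_apply2_le[of _ x y] in \<open>auto simp: mult.commute\<close>)

lemma bounded_bilinear_tensor: "bounded_bilinear tensor"
proof
  show "\<exists>K. \<forall>a b. norm (tensor a b) \<le> norm a * norm b * K"
    by (rule exI[of _ 1]) (simp add: norm_tensor_le)
qed (auto intro!: blinfun_eqI simp: blinfun.bilinear_simps)

interpretation tensor: bounded_bilinear tensor
  by (rule bounded_bilinear_tensor)

text \<open>Absolute convergence provides a limit in the complete space of functionals, and
  evaluation at every \<open>T\<close> identifies it. Representations can thus be checked on scalar
  series.\<close>

lemma proj_rep_iff:
  "proj_rep u x y \<longleftrightarrow> summable (\<lambda>n. norm (x n) * norm (y n)) \<and>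
     (\<forall>T. (\<lambda>n. blinfun_apply (blinfun_apply T (x n)) (y n)) sums blinfun_apply u T)"
proof
  assume r: "proj_rep u x y"
  then have "(\<lambda>n. blinfun_apply (tensor (x n) (y n)) T) sums blinfun_apply u T" for T
    unfolding proj_rep_def by (intro bounded_linear.sums[OF blinfun.bounded_linear_left]) auto
  with r show "summable (\<lambda>n. norm (x n) * norm (y n)) \<and>
     (\<forall>T. (\<lambda>n. blinfun_apply (blinfun_apply T (x n)) (y n)) sums blinfun_apply u T)"
    by (simp add: proj_rep_def)
next
  assume r: "summable (\<lambda>n. norm (x n) * norm (y n)) \<and>
     (\<forall>T. (\<lambda>n. blinfun_apply (blinfun_apply T (x n)) (y n)) sums blinfun_apply u T)"
  have "summable (\<lambda>n. tensor (x n) (y n))"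
    by (rule summable_comparison_test'[OF conjunct1[OF r]]) (rule norm_tensor_le)
  then obtain v where v: "(\<lambda>n. tensor (x n) (y n)) sums v" by (auto simp: summable_def)
  have "v = u"
  proof (rule blinfun_eqI)
    fix T
    have "(\<lambda>n. blinfun_apply (tensor (x n) (y n)) T) sums blinfun_apply v T"
      by (intro bounded_linear.sums[OF blinfun.bounded_linear_left] v)
    then show "blinfun_apply v T = blinfun_apply u T" using r sums_unique2 by auto
  qed
  with v r show "proj_rep u x y" by (simp add: proj_rep_def)
qed

text \<open>Cutting off the left factors alone pads the finite sum to a series, whatever
  \<open>y\<close> is beyond \<open>n\<close>.\<close>

lemma proj_rep_finite:
  fixes n :: nat
  assumes "u = (\<Sum>k<n. tensor (x k) (y k))"
  defines "x' \<equiv> \<lambda>k. if k < n then x k else 0"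
  shows "proj_rep u x' y" "(\<Sum>k. norm (x' k) * norm (y k)) = (\<Sum>k<n. norm (x k) * norm (y k))"
proof -
  have "(\<lambda>k. norm (x' k) * norm (y k)) sums (\<Sum>k<n. norm (x' k) * norm (y k))"
    by (rule sums_finite) (auto simp: x'_def)
  moreover have "(\<Sum>k<n. norm (x' k) * norm (y k)) = (\<Sum>k<n. norm (x k) * norm (y k))"
    by (simp add: x'_def)
  ultimately have *: "(\<lambda>k. norm (x' k) * norm (y k)) sums (\<Sum>k<n. norm (x k) * norm (y k))"
    by simp
  then show "(\<Sum>k. norm (x' k) * norm (y k)) = (\<Sum>k<n. norm (x k) * norm (y k))"
    by (simp add: sums_iff)
  have "(\<lambda>k. tensor (x' k) (y k)) sums (\<Sum>k<n. tensor (x' k) (y k))"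
    by (rule sums_finite) (auto simp: x'_def tensor.zero_left)
  moreover have "(\<Sum>k<n. tensor (x' k) (y k)) = u"
    by (simp add: x'_def assms(1))
  ultimately show "proj_rep u x' y"
    using * by (simp add: proj_rep_def sums_iff)
qed

lemma proj_rep_scaleR:
  assumes "proj_rep u x y"
  shows "proj_rep (c *\<^sub>R u) (\<lambda>n. c *\<^sub>R x n) y"
    "(\<Sum>n. norm (c *\<^sub>R x n) * norm (y n)) = \<bar>c\<bar> * (\<Sum>n. norm (x n) * norm (y n))"
proof -
  have s: "summable (\<lambda>n. norm (x n) * norm (y n))" using assms by (simp add: proj_rep_def)
  show "(\<Sum>n. norm (c *\<^sub>R x n) * norm (y n)) = \<bar>c\<bar> * (\<Sum>n. norm (x n) * norm (y n))"
    using suminf_mult[OF s, of "\<bar>c\<bar>"] by (simp add: mult.assoc)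
  show "proj_rep (c *\<^sub>R u) (\<lambda>n. c *\<^sub>R x n) y"
    using assms summable_mult[OF s, of "\<bar>c\<bar>"] sums_scaleR_right[of "\<lambda>n. tensor (x n) (y n)" u c]
    by (simp add: proj_rep_def tensor.scaleR_left mult.assoc)
qed

text \<open>The two series are interleaved, one on the even and one on the odd indices.\<close>

lemma proj_rep_add:
  assumes "proj_rep u x y" "proj_rep v z w"
  defines "a \<equiv> \<lambda>n. if even n then x (n div 2) else z ((n - 1) div 2)"
    and "b \<equiv> \<lambda>n. if even n then y (n div 2) else w ((n - 1) div 2)"
  shows "proj_rep (u + v) a b"
    "(\<Sum>n. norm (a n) * norm (b n)) = (\<Sum>n. norm (x n) * norm (y n)) + (\<Sum>n. norm (z n) * norm (w n))"
proof -
  have 1: "(\<lambda>n. norm (x n) * norm (y n)) sums (\<Sum>n. norm (x n) * norm (y n))"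
    "(\<lambda>n. norm (z n) * norm (w n)) sums (\<Sum>n. norm (z n) * norm (w n))"
    using assms by (auto simp: proj_rep_def summable_sums)
  have "(\<lambda>n. norm (a n) * norm (b n)) =
      (\<lambda>n. if even n then norm (x (n div 2)) * norm (y (n div 2))
           else norm (z ((n - 1) div 2)) * norm (w ((n - 1) div 2)))"
    by (auto simp: a_def b_def)
  with sums_if[OF 1(2) 1(1)] have 2: "(\<lambda>n. norm (a n) * norm (b n)) sums
     ((\<Sum>n. norm (x n) * norm (y n)) + (\<Sum>n. norm (z n) * norm (w n)))"
    by (simp add: add.commute)
  then show "(\<Sum>n. norm (a n) * norm (b n)) = (\<Sum>n. norm (x n) * norm (y n)) + (\<Sum>n. norm (z n) * norm (w n))"
    by (simp add: sums_iff)
  have "(\<lambda>n. blinfun_apply (blinfun_apply T (a n)) (b n)) sums blinfun_apply (u + v) T" for T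
  proof -
    have 3: "(\<lambda>n. blinfun_apply (blinfun_apply T (x n)) (y n)) sums blinfun_apply u T"
        "(\<lambda>n. blinfun_apply (blinfun_apply T (z n)) (w n)) sums blinfun_apply v T"
      using assms by (auto simp: proj_rep_iff)
    have "(\<lambda>n. blinfun_apply (blinfun_apply T (a n)) (b n)) =
      (\<lambda>n. if even n then blinfun_apply (blinfun_apply T (x (n div 2))) (y (n div 2))
           else blinfun_apply (blinfun_apply T (z ((n - 1) div 2))) (w ((n - 1) div 2)))"
      by (auto simp: a_def b_def)
    with sums_if[OF 3(2) 3(1)] show ?thesis by (simp add: add.commute blinfun.add_left)
  qed
  then show "proj_rep (u + v) a b" using 2 by (auto simp: proj_rep_iff sums_iff)
qed

section \<open>The projective norm as a seminorm, and its duality with operators\<close>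

lemma subspace_proj_space: "subspace proj_space"
proof (rule subspaceI)
  show "0 \<in> proj_space"
    using proj_rep_finite(1)[where n=0 and u=0] by (auto simp: proj_space_def)
qed (use proj_rep_add(1) proj_rep_scaleR(1) in \<open>unfold proj_space_def, blast+\<close>)

lemma suminf_norms_nonneg: "proj_rep u x y \<Longrightarrow> 0 \<le> (\<Sum>n. norm (x n) * norm (y n))"
  by (auto simp: proj_rep_def intro: suminf_nonneg)

lemma pnorm_le: "proj_rep u x y \<Longrightarrow> pnorm u \<le> (\<Sum>n. norm (x n) * norm (y n))"
  unfolding pnorm_def
  by (rule cInf_lower) (auto intro!: bdd_belowI[where m=0] suminf_norms_nonneg)

text \<open>Membership in \<open>proj_space\<close> makes the infimum range over a nonempty
  set.\<close>

lemma pnorm_greatest: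
  assumes "u \<in> proj_space" "\<And>x y. proj_rep u x y \<Longrightarrow> c \<le> (\<Sum>n. norm (x n) * norm (y n))"
  shows "c \<le> pnorm u"
  unfolding pnorm_def by (rule cInf_greatest) (use assms in \<open>auto simp: proj_space_def\<close>)

lemma pnorm_nonneg: "u \<in> proj_space \<Longrightarrow> 0 \<le> pnorm u"
  by (rule pnorm_greatest) (auto intro: suminf_norms_nonneg)

lemma pnorm_add:
  assumes u: "u \<in> proj_space" and v: "v \<in> proj_space"
  shows "pnorm (u + v) \<le> pnorm u + pnorm v"
proof -
  \<comment> \<open>The two infima are taken one after the other, each with the representation of
    the other summand held fixed.\<close>
  have "pnorm (u + v) - pnorm u \<le> pnorm v"
  proof (rule pnorm_greatest[OF v])
    fix z w assume r: "proj_rep v z w"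
    have "pnorm (u + v) - (\<Sum>n. norm (z n) * norm (w n)) \<le> pnorm u"
    proof (rule pnorm_greatest[OF u])
      fix x y assume r': "proj_rep u x y"
      show "pnorm (u + v) - (\<Sum>n. norm (z n) * norm (w n)) \<le> (\<Sum>n. norm (x n) * norm (y n))"
        using pnorm_le[OF proj_rep_add(1)[OF r' r]] proj_rep_add(2)[OF r' r] by simp
    qed
    then show "pnorm (u + v) - pnorm u \<le> (\<Sum>n. norm (z n) * norm (w n))" by simp
  qed
  then show ?thesis by simp
qed

lemma pnorm_scaleR_le:
  assumes u: "u \<in> proj_space"
  shows "pnorm (c *\<^sub>R u) \<le> \<bar>c\<bar> * pnorm u"
proof (cases "c = 0")
  case True
  obtain x y where "proj_rep u x y" using u by (auto simp: proj_space_def)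
  from pnorm_le[OF proj_rep_scaleR(1)[OF this, of c]] proj_rep_scaleR(2)[OF this, of c] True
  show ?thesis by simp
next
  case False
  have "pnorm (c *\<^sub>R u) / \<bar>c\<bar> \<le> pnorm u"
  proof (rule pnorm_greatest[OF u])
    fix x y assume r: "proj_rep u x y"
    show "pnorm (c *\<^sub>R u) / \<bar>c\<bar> \<le> (\<Sum>n. norm (x n) * norm (y n))"
      using pnorm_le[OF proj_rep_scaleR(1)[OF r, of c]] proj_rep_scaleR(2)[OF r, of c] False
      by (simp add: field_simps)
  qed
  then show ?thesis using False by (simp add: field_simps)
qed

lemma zero_in_proj_space: "0 \<in> proj_space"
  by (rule subspace_0[OF subspace_proj_space])

lemma pnorm_0: "pnorm (0 :: ('a::real_normed_vector, 'b::real_normed_vector) ptensor) = 0"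
proof -
  have 0: "(0 :: ('a, 'b) ptensor) \<in> proj_space" by (rule zero_in_proj_space)
  show ?thesis using pnorm_scaleR_le[OF 0, of 0] pnorm_nonneg[OF 0] by simp
qed

lemma alg_tensor_subset_proj_space: "alg_tensor \<subseteq> proj_space"
  using proj_rep_finite(1) by (fastforce simp: alg_tensor_def proj_space_def)

lemma tensor_in_proj_space: "tensor x y \<in> proj_space"
proof -
  have "tensor x y \<in> alg_tensor"
    unfolding alg_tensor_def mem_Collect_eq
    by (intro exI[of _ "1::nat"] exI[of _ "\<lambda>_. x"] exI[of _ "\<lambda>_. y"]) simp
  then show ?thesis using alg_tensor_subset_proj_space by (rule rev_subsetD)
qed

lemma pnorm_sum_le: 
  "pnorm (\<Sum>k<n. tensor (x k) (y k)) \<le> (\<Sum>k<(n::nat). norm (x k) * norm (y k))"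
  using pnorm_le[OF proj_rep_finite(1)[where x=x and y=y and n=n, OF refl]]
    proj_rep_finite(2)[where x=x and y=y and n=n, OF refl]
  by simp

text \<open>A termwise estimate in each representation, followed by the infimum. This is the easy
  half of the duality; \<open>norming_operator\<close> supplies the other.\<close>

lemma abs_apply_le_pnorm:
  assumes "u \<in> proj_space"
  shows "\<bar>blinfun_apply u T\<bar> \<le> norm T * pnorm u"
proof (cases "norm T = 0")
  case True
  then show ?thesis by (simp add: blinfun.bilinear_simps)
next
  case False
  have "\<bar>blinfun_apply u T\<bar> / norm T \<le> pnorm u"
  proof (rule pnorm_greatest[OF assms])
    fix x y assume r: "proj_rep u x y"
    then have s: "summable (\<lambda>n. norm (x n) * norm (y n))"
      and u: "(\<lambda>n. blinfun_apply (blinfun_apply T (x n)) (y n)) sums blinfun_apply u T"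
      by (auto simp: proj_rep_iff)
    have "norm (\<Sum>n. blinfun_apply (blinfun_apply T (x n)) (y n)) \<le> (\<Sum>n. norm T * (norm (x n) * norm (y n)))"
      by (rule norm_suminf_le) (use s abs_blinfun_apply2_le[of T] in \<open>auto intro: summable_mult\<close>)
    then show "\<bar>blinfun_apply u T\<bar> / norm T \<le> (\<Sum>n. norm (x n) * norm (y n))"
      using False u suminf_mult[OF s, of "norm T"] by (simp add: sums_iff field_simps)
  qed
  then show ?thesis using False by (simp add: field_simps)
qed

lemma pnorm_tensor: "pnorm (tensor x y) = norm x * norm y"
proof (rule antisym)
  show "pnorm (tensor x y) \<le> norm x * norm y"
    using pnorm_sum_le[of "\<lambda>_. x" "\<lambda>_. y" 1] by simp
  obtain f :: "'a \<Rightarrow>\<^sub>L real" where f: "norm f \<le> 1" "f x = norm x" by (rule norming_functional)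
  obtain g :: "'b \<Rightarrow>\<^sub>L real" where g: "norm g \<le> 1" "g y = norm y" by (rule norming_functional)
  \<comment> \<open>The rank-one form built from two norming functionals attains the lower bound at
    \<open>tensor x y\<close>.\<close>
  define T where "T = blinfun_scaleR_left g o\<^sub>L f"
  have T: "blinfun_apply (blinfun_apply T a) b = f a * g b" for a b
    by (simp add: T_def blinfun.scaleR_left)
  have "norm T \<le> 1"
  proof (rule norm_blinfun_bound)
    fix a
    have "norm (T a) = norm (f a) * norm g" by (simp add: T_def)
    also have "\<dots> \<le> norm a * 1"
      using norm_blinfun[of f a] f(1) g(1) mult_right_mono[OF f(1), of "norm a"]
      by (intro mult_mono) auto
    finally show "norm (T a) \<le> 1 * norm a" by simp
  qed simp
  then have "norm T * pnorm (tensor x y) \<le> pnorm (tensor x y)"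
    using mult_right_mono[of "norm T" 1 "pnorm (tensor x y)"] pnorm_nonneg[OF tensor_in_proj_space[of x y]]
    by simp
  then show "norm x * norm y \<le> pnorm (tensor x y)"
    using abs_apply_le_pnorm[OF tensor_in_proj_space[of x y], of T] by (simp add: T f g)
qed

text \<open>Outside \<open>proj_space\<close> the value of \<open>pnorm\<close> is junk, so the Hahn-Banach theorem is applied to
  \<open>pnorm\<close> composed with an algebraic projection onto \<open>proj_space\<close>. The resulting functional
  determines \<open>T\<close> on elementary tensors.\<close>

lemma norming_operator:
  fixes u :: "('a::real_normed_vector, 'b::real_normed_vector) ptensor"
  assumes u: "u \<in> proj_space"
  obtains T :: "'a \<Rightarrow>\<^sub>L ('b \<Rightarrow>\<^sub>L real)" where "norm T \<le> 1" "blinfun_apply u T = pnorm u"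
proof -
  obtain P :: "('a, 'b) ptensor \<Rightarrow> ('a, 'b) ptensor"
    where P: "range P \<subseteq> proj_space" "linear P" "\<And>v. v \<in> proj_space \<Longrightarrow> P v = v"
    using real_vector.linear_exists_left_inverse_on[OF linear_id subspace_proj_space]
    by auto
  have "sublinear (\<lambda>v. pnorm (P v))"
  proof (rule sublinearI)
    show "pnorm (P (v + w)) \<le> pnorm (P v) + pnorm (P w)" for v w
      using pnorm_add[of "P v" "P w"] P by (auto simp: linear_add)
    show "pnorm (P 0) = 0"
      by (simp add: P(3)[OF zero_in_proj_space] pnorm_0)
    show "pnorm (P (t *\<^sub>R v)) \<le> t * pnorm (P v)" if "0 < t" for t v
      using pnorm_scaleR_le[of "P v" t] P that by (auto simp: linear_cmul)
  qed
  from hahn_banach_sublinear[OF this, of u] obtain \<phi>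
    where \<phi>: "linear \<phi>" "\<And>v. \<phi> v \<le> pnorm (P v)" "\<phi> u = pnorm (P u)" by auto
  have \<phi>_abs: "\<bar>\<phi> v\<bar> \<le> pnorm v" if v: "v \<in> proj_space" for v
  proof -
    have "- v \<in> proj_space" by (rule subspace_neg[OF subspace_proj_space v])
    moreover from this have "\<phi> (- v) \<le> pnorm v"
      using \<phi>(2)[of "- v"] P(3) pnorm_scaleR_le[OF v, of "- 1"] by simp
    ultimately show ?thesis
      using \<phi>(2)[of v] P(3)[OF v] linear_neg[OF \<phi>(1), of v] by simp
  qed
  have \<phi>_tensor: "\<bar>\<phi> (tensor x y)\<bar> \<le> norm x * norm y" for x y
    using \<phi>_abs[OF tensor_in_proj_space] by (simp add: pnorm_tensor)
  have lin2: "bounded_linear (\<lambda>y. \<phi> (tensor x y))" for x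
  proof (rule bounded_linear_intro[where K="norm x"])
    fix a b show "\<phi> (tensor x (a + b)) = \<phi> (tensor x a) + \<phi> (tensor x b)"
      by (simp add: tensor.add_right linear_add[OF \<phi>(1)])
  next
    fix r b show "\<phi> (tensor x (r *\<^sub>R b)) = r *\<^sub>R \<phi> (tensor x b)"
      by (simp add: tensor.scaleR_right linear_cmul[OF \<phi>(1)])
  next
    fix b show "norm (\<phi> (tensor x b)) \<le> norm b * norm x"
      using \<phi>_tensor[of x b] by (simp add: mult.commute)
  qed
  define S where "S x = Blinfun (\<lambda>y. \<phi> (tensor x y))" for x
  have S: "blinfun_apply (S x) y = \<phi> (tensor x y)" for x y
    by (simp add: S_def bounded_linear_Blinfun_apply[OF lin2])
  have S_norm: "norm (S x) \<le> norm x" for x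
    by (rule norm_blinfun_bound) (use \<phi>_tensor in \<open>auto simp: S\<close>)
  have S_lin: "bounded_linear S"
    by (rule bounded_linear_intro[where K=1])
      (auto intro!: blinfun_eqI simp: S blinfun.bilinear_simps tensor.add_left tensor.scaleR_left
         linear_add[OF \<phi>(1)] linear_cmul[OF \<phi>(1)] S_norm)
  define T where "T = Blinfun S"
  have T: "blinfun_apply (blinfun_apply T x) y = \<phi> (tensor x y)" for x y
    by (simp add: T_def bounded_linear_Blinfun_apply[OF S_lin] S)
  show thesis
  proof (rule that[of T])
    show "norm T \<le> 1"
      by (rule norm_blinfun_bound) (auto simp: T_def bounded_linear_Blinfun_apply[OF S_lin] S_norm)
    obtain x y where r: "proj_rep u x y" using u by (auto simp: proj_space_def)
    let ?s = "\<lambda>m. \<Sum>k<m. tensor (x k) (y k)"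
    let ?n = "\<lambda>k. norm (x k) * norm (y k)"
    have sm: "summable ?n" and us: "(\<lambda>k. tensor (x k) (y k)) sums u"
      using r by (auto simp: proj_rep_def)
    \<comment> \<open>\<open>T\<close> reproduces \<open>\<phi>\<close> on elementary tensors only,
      and linearity extends this to finite sums. For the series, the remainder lies in
      \<open>proj_space\<close> and its \<open>pnorm\<close> is at most the tail of a convergent
      series, so \<open>\<phi>\<close> may be applied term by term.\<close>
    have "\<bar>\<phi> u - (\<Sum>k<m. \<phi> (tensor (x k) (y k)))\<bar> \<le> (\<Sum>k. ?n (k + m))" for m
    proof -
      have pr: "proj_rep (u - ?s m) (\<lambda>k. x (k + m)) (\<lambda>k. y (k + m))"
        unfolding proj_rep_def
        using sums_split_initial_segment[OF us, of m] summable_ignore_initial_segment[OF sm, of m]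
        by simp
      then have "u - ?s m \<in> proj_space" by (auto simp: proj_space_def)
      from \<phi>_abs[OF this] pnorm_le[OF pr] show ?thesis
        by (simp add: linear_diff[OF \<phi>(1)] linear_sum[OF \<phi>(1)])
    qed
    then have "(\<lambda>m. \<phi> u - (\<Sum>k<m. \<phi> (tensor (x k) (y k)))) \<longlonglongrightarrow> 0"
      by (intro Lim_null_comparison[OF _ suminf_exist_split2[OF sm]]) auto
    then have "(\<lambda>k. \<phi> (tensor (x k) (y k))) sums \<phi> u"
      unfolding sums_def using tendsto_diff[OF tendsto_const[of "\<phi> u"]] by fastforce
    moreover have "(\<lambda>k. \<phi> (tensor (x k) (y k))) sums blinfun_apply u T"
      using conjunct2[OF r[unfolded proj_rep_iff], rule_format, of T] by (simp add: T)
    ultimately show "blinfun_apply u T = pnorm u"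
      using \<phi>(3) P(3)[OF u] sums_unique2 by metis
  qed
qed

section \<open>Operators on c0 and strict convexity\<close>

lift_definition c0_nth :: "c0 \<Rightarrow> nat \<Rightarrow> real" is apply_bcontfun .

lemma c0_nth_tendsto_0: "c0_nth x \<longlonglongrightarrow> 0"
  by transfer simp

lemma abs_c0_nth_le: "\<bar>c0_nth x n\<bar> \<le> norm x"
  using norm_bounded[of "c0_rep x" n] by (simp add: c0_nth.rep_eq norm_c0.rep_eq)

lemma norm_c0_le: "(\<And>n. \<bar>c0_nth x n\<bar> \<le> b) \<Longrightarrow> norm x \<le> b"
  by (simp add: c0_nth.rep_eq norm_c0.rep_eq norm_bound)

lemma c0_nth_add [simp]: "c0_nth (x + y) n = c0_nth x n + c0_nth y n"
  by transfer simp

lemma c0_nth_diff [simp]: "c0_nth (x - y) n = c0_nth x n - c0_nth y n"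
  by transfer simp

lemma c0_nth_scaleR [simp]: "c0_nth (r *\<^sub>R x) n = r * c0_nth x n"
  by transfer simp

lemma bounded_linear_c0_nth: "bounded_linear (\<lambda>x. c0_nth x n)"
  by (rule bounded_linear_intro[where K=1]) (auto simp: abs_c0_nth_le)

lemma c0_nth_sum [simp]: "c0_nth (sum f A) n = (\<Sum>i\<in>A. c0_nth (f i) n)"
  by (rule linear_sum[OF bounded_linear.linear[OF bounded_linear_c0_nth]])

text \<open>Meant for null sequences: these are bounded, so both abstraction maps are
  inverted.\<close>

definition c0_of :: "(nat \<Rightarrow> real) \<Rightarrow> c0" where
  "c0_of f = Abs_c0 (Bcontfun f)"

lemma c0_nth_c0_of:
  assumes "f \<longlonglongrightarrow> 0"
  shows "c0_nth (c0_of f) = f"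
proof -
  have "bounded (range f)"
    using convergent_imp_bounded[OF assms] .
  then have "f \<in> bcontfun"
    by (auto simp: bcontfun_def)
  then have "apply_bcontfun (Bcontfun f) = f"
    by (rule Bcontfun_inverse)
  with assms show ?thesis
    by (simp add: c0_nth.rep_eq c0_of_def Abs_c0_inverse)
qed

definition c0_unit :: "nat \<Rightarrow> c0" where
  "c0_unit n = c0_of (\<lambda>k. if k = n then 1 else 0)"

lemma c0_nth_c0_unit [simp]: "c0_nth (c0_unit n) k = (if k = n then 1 else 0)"
proof -
  have "(\<lambda>k. if k = n then 1 else (0::real)) \<longlonglongrightarrow> 0"
    by (rule tendsto_eventually) (auto simp: eventually_sequentially intro!: exI[of _ "Suc n"])
  then show ?thesis by (simp add: c0_unit_def c0_nth_c0_of)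
qed

lemma norm_c0_unit_le: "norm (c0_unit n) \<le> 1"
  by (rule norm_c0_le) simp

lemma c0_nth_truncate:
  "c0_nth (\<Sum>n<N. c0_nth x n *\<^sub>R c0_unit n) k = (if k < N then c0_nth x k else 0)"
  by (simp add: if_distrib[of "\<lambda>a. _ * a"] sum.delta cong: if_cong)

lemma norm_c0_truncate_le: "norm (\<Sum>n<N. c0_nth x n *\<^sub>R c0_unit n) \<le> norm x"
  by (rule norm_c0_le) (simp only: c0_nth_truncate, simp add: abs_c0_nth_le)

text \<open>The remainder vanishes in the first \<open>m\<close> coordinates and agrees with
  \<open>x\<close> up to sign in the others, which are uniformly small because \<open>x\<close> is a
  null sequence.\<close>

lemma c0_sums: "(\<lambda>n. c0_nth x n *\<^sub>R c0_unit n) sums x"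
  unfolding sums_def
proof (rule LIMSEQ_I)
  fix e :: real assume e: "0 < e"
  then obtain N where N: "\<And>n. n \<ge> N \<Longrightarrow> \<bar>c0_nth x n\<bar> < e / 2"
    using LIMSEQ_D[OF c0_nth_tendsto_0[of x], of "e / 2"] by auto
  have "norm ((\<Sum>n<m. c0_nth x n *\<^sub>R c0_unit n) - x) < e" if "m \<ge> N" for m
  proof -
    have "norm ((\<Sum>n<m. c0_nth x n *\<^sub>R c0_unit n) - x) \<le> e / 2"
    proof (rule norm_c0_le)
      fix n
      have "\<bar>c0_nth x n\<bar> \<le> e / 2" if "\<not> n < m"
        using N[of n] that \<open>m \<ge> N\<close> by simp
      then show "\<bar>c0_nth ((\<Sum>n<m. c0_nth x n *\<^sub>R c0_unit n) - x) n\<bar> \<le> e / 2"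
        using e by (simp only: c0_nth_diff c0_nth_truncate) simp
    qed
    then show ?thesis using e by simp
  qed
  then show "\<exists>no. \<forall>n\<ge>no. norm ((\<Sum>n<n. c0_nth x n *\<^sub>R c0_unit n) - x) < e" by blast
qed

section \<open>Strict convexity and finiteness of the norming vectors\<close>

text \<open>A form for the closed ball: if the sum has norm at least 2, the triangle inequality
  forces both norms to be 1.\<close>

lemma strictly_convexD:
  fixes a b :: "'a::real_normed_vector"
  assumes "strictly_convex TYPE('a)" "norm a \<le> 1" "norm b \<le> 1" "norm (a + b) \<ge> 2"
  shows "a = b"
proof (rule ccontr)
  assume "a \<noteq> b"
  moreover have "norm a = 1" "norm b = 1"
    using norm_triangle_ineq[of a b] assms by auto
  ultimately have "norm ((1/2) *\<^sub>R (a + b)) < 1"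
    using assms(1) by (auto simp: strictly_convex_def)
  then show False using assms(4) by simp
qed

text \<open>Both points \<open>x \<plusminus> (1 - \<bar>x n\<bar>) e n\<close> lie in the unit ball of \<open>c0\<close>, and \<open>T x\<close> is the midpoint
  of their images.\<close>

lemma strictly_convex_c0_operator:
  fixes T :: "c0 \<Rightarrow>\<^sub>L 'a::real_normed_vector"
  assumes sc: "strictly_convex TYPE('a)" and T: "norm T \<le> 1" and x: "norm x \<le> 1"
    and Tx: "norm (T x) \<ge> 1" and n: "\<bar>c0_nth x n\<bar> < 1"
  shows "T (c0_unit n) = 0"
proof -
  define d where "d = 1 - \<bar>c0_nth x n\<bar>"
  have d: "d > 0" using n by (simp add: d_def)
  have ball: "norm (T z) \<le> 1" if "norm z \<le> 1" for z
    using norm_blinfun[of T z] mult_mono[OF T that] by simp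
  have nth: "\<bar>c0_nth x k\<bar> \<le> 1" for k using abs_c0_nth_le[of x k] x by simp
  have "norm (x + c *\<^sub>R c0_unit n) \<le> 1" if "\<bar>c\<bar> \<le> d" for c
  proof (rule norm_c0_le)
    fix k show "\<bar>c0_nth (x + c *\<^sub>R c0_unit n) k\<bar> \<le> 1"
      using nth[of k] that by (cases "k = n") (auto simp: d_def)
  qed
  from this[of d] this[of "- d"] d
  have 1: "norm (x + d *\<^sub>R c0_unit n) \<le> 1" "norm (x - d *\<^sub>R c0_unit n) \<le> 1"
    by simp_all
  have "2 \<le> norm (T (x + d *\<^sub>R c0_unit n) + T (x - d *\<^sub>R c0_unit n))"
    using Tx by (simp add: blinfun.bilinear_simps flip: scaleR_2)
  \<comment> \<open>The two images coincide, and their difference is \<open>2 * d\<close> times the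
    image of the unit vector.\<close>
  from strictly_convexD[OF sc ball[OF 1(1)] ball[OF 1(2)] this]
  have "(2 * d) *\<^sub>R T (c0_unit n) = 0"
    by (simp add: blinfun.bilinear_simps algebra_simps flip: scaleR_2)
  then show ?thesis using d by simp
qed

lemma finite_norming_set:
  fixes T :: "c0 \<Rightarrow>\<^sub>L ('b::real_normed_vector \<Rightarrow>\<^sub>L real)"
  assumes scY: "strictly_convex TYPE('b)" and scY': "strictly_convex TYPE('b \<Rightarrow>\<^sub>L real)"
    and T: "norm T \<le> 1"
  shows "finite {y. norm y \<le> 1 \<and> (\<exists>x. norm x \<le> 1 \<and> T x y = 1)}" (is "finite ?G")
proof (cases "?G = {}")
  case True
  show ?thesis unfolding True by (rule finite.emptyI)
next
  case False
  have norm_ge: "norm (T x) \<ge> 1" if "norm y \<le> 1" "T x y = 1" for x y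
    using norm_blinfun[of "T x" y] that mult_left_mono[OF that(1), of "norm (T x)"] by simp
  define F where "F = {n. T (c0_unit n) \<noteq> 0}"
  have peak: "\<bar>c0_nth x n\<bar> = 1" if "norm x \<le> 1" "norm (T x) \<ge> 1" "n \<in> F" for x n
    using strictly_convex_c0_operator[OF scY' T that(1,2), of n] that(3) abs_c0_nth_le[of x n] that(1)
    by (force simp: F_def)
  \<comment> \<open>A single norming point bounds \<open>F\<close>: its coordinates have modulus 1
    on \<open>F\<close> but tend to 0.\<close>
  obtain x0 where x0: "norm x0 \<le> 1" "norm (T x0) \<ge> 1"
    using False norm_ge by blast
  obtain N where N: "\<And>n. n \<ge> N \<Longrightarrow> \<bar>c0_nth x0 n\<bar> < 1"
    using LIMSEQ_D[OF c0_nth_tendsto_0[of x0], of 1] by auto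
  have "F \<subseteq> {..<N}"
  proof
    fix n assume "n \<in> F"
    then show "n \<in> {..<N}" using peak[OF x0, of n] N[of n] by (cases "n < N") auto
  qed
  then have F: "finite F" by (rule finite_subset) simp
  \<comment> \<open>The possible images, indexed by the sign patterns on \<open>F\<close>.
    Extensional functions make the index set finite, hence the \<open>restrict\<close>
    below.\<close>
  define V where "V = (\<lambda>s. \<Sum>n\<in>F. s n *\<^sub>R T (c0_unit n)) ` (PiE F (\<lambda>_. {-1, 1}))"
  have finV: "finite V" unfolding V_def by (intro finite_imageI finite_PiE F) simp
  have TV: "T x \<in> V" if "norm x \<le> 1" "norm (T x) \<ge> 1" for x
  proof -
    have "(\<lambda>n. T (c0_nth x n *\<^sub>R c0_unit n)) sums T x"
      by (rule bounded_linear.sums[OF blinfun.bounded_linear_right c0_sums])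
    moreover have "(\<lambda>n. T (c0_nth x n *\<^sub>R c0_unit n)) sums (\<Sum>n\<in>F. T (c0_nth x n *\<^sub>R c0_unit n))"
      by (rule sums_finite[OF F]) (simp add: F_def blinfun.scaleR_right)
    ultimately have "T x = (\<Sum>n\<in>F. c0_nth x n *\<^sub>R T (c0_unit n))"
      by (simp add: sums_unique2 blinfun.scaleR_right)
    also have "\<dots> = (\<Sum>n\<in>F. restrict (c0_nth x) F n *\<^sub>R T (c0_unit n))"
      by (intro sum.cong) auto
    also have "\<dots> \<in> V"
      unfolding V_def
    proof (rule imageI, rule PiE_I)
      fix n assume "n \<in> F"
      with peak[OF that, of n] show "restrict (c0_nth x) F n \<in> {- 1, 1}" by auto
    qed simp
    finally show ?thesis .
  qed
  define Y where "Y v = {y. norm y \<le> 1 \<and> blinfun_apply v y = 1 \<and> norm v \<le> 1}" for v :: "'b \<Rightarrow>\<^sub>L real"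
  have "finite (Y v)" for v
  proof -
    have eq: "y = z" if "y \<in> Y v" "z \<in> Y v" for y z
    proof (rule strictly_convexD[OF scY])
      \<comment> \<open>\<open>v\<close> takes the value 2 at \<open>y + z\<close> and has norm at
        most 1, so the sum is as long as strict convexity allows only for
        \<open>y = z\<close>.\<close>
      have "2 \<le> norm v * norm (y + z)"
        using norm_blinfun[of v "y + z"] that by (simp add: Y_def blinfun.add_right)
      also have "\<dots> \<le> norm (y + z)"
        using that mult_right_mono[of "norm v" 1 "norm (y + z)"] by (simp add: Y_def)
      finally show "2 \<le> norm (y + z)" .
    qed (use that in \<open>auto simp: Y_def\<close>)
    show ?thesis
    proof (cases "Y v = {}")
      case False
      then obtain y where "y \<in> Y v" by blast
      then have "Y v \<subseteq> {y}" using eq by blast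
      then show ?thesis by (rule finite_subset) simp
    qed simp
  qed
  moreover have "?G \<subseteq> (\<Union>v\<in>V. Y v)"
  proof
    fix y assume "y \<in> ?G"
    then obtain x where x: "norm y \<le> 1" "norm x \<le> 1" "T x y = 1" by auto
    have "norm (T x) \<le> 1"
      using norm_blinfun[of T x] mult_mono[OF T x(2)] by simp
    then have "y \<in> Y (T x)" using x by (simp add: Y_def)
    then show "y \<in> (\<Union>v\<in>V. Y v)" using TV[OF x(2) norm_ge[OF x(1,3)]] by blast
  qed
  ultimately show ?thesis using finV by (meson finite_UN finite_subset)
qed

section \<open>Integration in c0 and the passage to a finite representation\<close>

text \<open>The coordinatewise integral lies in \<open>c0\<close> by dominated convergence, so no Bochner integral
  in \<open>c0\<close> is needed.\<close>

lemma c0_set_integral: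
  fixes M :: "'w measure" and X :: "'w \<Rightarrow> c0"
  assumes "finite_measure M" and X1: "\<And>w. w \<in> space M \<Longrightarrow> norm (X w) \<le> 1"
    and mX [measurable]: "\<And>n. (\<lambda>w. c0_nth (X w) n) \<in> borel_measurable M"
    and A [measurable]: "A \<in> sets M"
  obtains a :: c0 where "norm a \<le> measure M A"
    and "\<And>L :: c0 \<Rightarrow> real. bounded_linear L \<Longrightarrow> has_bochner_integral M (\<lambda>w. indicator A w * L (X w)) (L a)"
proof -
  interpret finite_measure M by fact
  define g where "g n = (\<integral>w. indicator A w * c0_nth (X w) n \<partial>M)" for n
  have nth: "\<bar>c0_nth (X w) n\<bar> \<le> 1" if "w \<in> space M" for w n
    using abs_c0_nth_le[of "X w" n] X1[OF that] by simp
  have int_nth: "integrable M (\<lambda>w. indicator A w * c0_nth (X w) n)" for n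
    by (rule integrable_const_bound[where B=1])
      (auto intro!: AE_I2 simp: nth indicator_def)
  \<comment> \<open>Each \<open>X w\<close> is a null sequence bounded by 1, and constants are
    integrable for a finite measure.\<close>
  have "g \<longlonglongrightarrow> (\<integral>w. 0 \<partial>M)"
    unfolding g_def
  proof (rule integral_dominated_convergence[where w="\<lambda>_. 1"])
    show "AE w in M. (\<lambda>n. indicator A w * c0_nth (X w) n) \<longlonglongrightarrow> 0"
      by (rule AE_I2) (rule tendsto_mult_right_zero[OF c0_nth_tendsto_0])
    show "AE w in M. norm (indicator A w * c0_nth (X w) n) \<le> 1" for n
      by (auto intro!: AE_I2 simp: nth indicator_def)
  qed auto
  then have g0: "g \<longlonglongrightarrow> 0" by simp
  define a where "a = c0_of g"
  have a: "c0_nth a = g" unfolding a_def by (rule c0_nth_c0_of[OF g0])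
  show thesis
  proof (rule that[of a])
    show "norm a \<le> measure M A"
    proof (rule norm_c0_le)
      fix n
      have "\<bar>g n\<bar> \<le> (\<integral>w. norm (indicator A w * c0_nth (X w) n) \<partial>M)"
        using integral_norm_bound[of M "\<lambda>w. indicator A w * c0_nth (X w) n"] by (simp add: g_def)
      also have "\<dots> \<le> (\<integral>w. indicator A w \<partial>M)"
      proof (rule integral_mono)
        show "integrable M (indicator A :: 'w \<Rightarrow> real)"
          by (rule integrable_real_indicator[OF A]) (simp add: less_top[symmetric])
        show "norm (indicator A w * c0_nth (X w) n) \<le> indicator A w" if "w \<in> space M" for w
          using nth[OF that, of n] by (simp add: indicator_def)
      qed (rule integrable_norm[OF int_nth])
      also have "\<dots> = measure M A" using sets.sets_into_space[OF A] by (simp add: Int_absorb2)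
      finally show "\<bar>c0_nth a n\<bar> \<le> measure M A" by (simp add: a)
    qed
    fix L :: "c0 \<Rightarrow> real" assume L: "bounded_linear L"
    obtain K where K: "\<And>x. norm (L x) \<le> norm x * K" "K > 0"
      using bounded_linear.pos_bounded[OF L] by blast
    have Ls: "(\<lambda>n. c0_nth x n * L (c0_unit n)) sums L x" for x
      using bounded_linear.sums[OF L c0_sums[of x]] by (simp add: linear_cmul[OF bounded_linear.linear[OF L]])
    have Lt: "(\<Sum>n<N. c0_nth x n * L (c0_unit n)) = L (\<Sum>n<N. c0_nth x n *\<^sub>R c0_unit n)" for x N
      by (simp add: linear_sum[OF bounded_linear.linear[OF L]] linear_cmul[OF bounded_linear.linear[OF L]])
    \<comment> \<open>Only the coordinates of \<open>X\<close> are assumed measurable, so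
      \<open>L (X w)\<close> is reached as the limit of its truncated expansions. Truncation does
      not increase the norm, whence the dominating constant \<open>K\<close>.\<close>
    define f where "f N w = indicator A w * (\<Sum>n<N. c0_nth (X w) n * L (c0_unit n))" for N w
    have f_meas [measurable]: "f N \<in> borel_measurable M" for N
      unfolding f_def by measurable
    have f_lim: "(\<lambda>N. f N w) \<longlonglongrightarrow> indicator A w * L (X w)" for w
      unfolding f_def using Ls[of "X w"] unfolding sums_def by (rule tendsto_mult_left)
    have f_bound: "norm (f N w) \<le> K" if "w \<in> space M" for N w
    proof -
      have "norm (L (\<Sum>n<N. c0_nth (X w) n *\<^sub>R c0_unit n)) \<le> norm (\<Sum>n<N. c0_nth (X w) n *\<^sub>R c0_unit n) * K"
        by (rule K(1))
      also have "\<dots> \<le> 1 * K"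
        using norm_c0_truncate_le[of "X w" N] X1[OF that] K(2) by (intro mult_right_mono) auto
      finally show ?thesis
        using K(2) by (simp add: f_def Lt indicator_def)
    qed
    have meas: "(\<lambda>w. indicator A w * L (X w)) \<in> borel_measurable M"
      by (rule borel_measurable_LIMSEQ_real[OF f_lim f_meas])
    have int: "integrable M (\<lambda>w. indicator A w * L (X w))"
      and lim: "(\<lambda>N. \<integral>w. f N w \<partial>M) \<longlonglongrightarrow> (\<integral>w. indicator A w * L (X w) \<partial>M)"
      by (rule integrable_dominated_convergence[where s=f and w="\<lambda>_. K", OF meas f_meas]
          integral_dominated_convergence[where s=f and w="\<lambda>_. K", OF meas f_meas];
        use f_lim f_bound in auto)+
    have "(\<integral>w. f N w \<partial>M) = (\<Sum>n<N. g n * L (c0_unit n))" for N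
    proof -
      have "f N = (\<lambda>w. \<Sum>n<N. (indicator A w * c0_nth (X w) n) * L (c0_unit n))"
        by (simp add: f_def sum_distrib_left mult.assoc fun_eq_iff)
      then show ?thesis
        using int_nth by (simp add: g_def)
    qed
    then have "(\<lambda>N. \<integral>w. f N w \<partial>M) \<longlonglongrightarrow> L a"
      using Ls[of a] by (simp add: sums_def a)
    then show "has_bochner_integral M (\<lambda>w. indicator A w * L (X w)) (L a)"
      using int LIMSEQ_unique[OF lim] by (simp add: has_bochner_integral_iff)
  qed
qed

text \<open>A common form of the hypotheses of \<open>NA_pi\<close> (a weighted counting measure) and \<open>INA_pi\<close>.\<close>

lemma FNA_pi_if_weak_integral:
  fixes u :: "(c0, 'b::real_normed_vector) ptensor" and M :: "'w measure"
  assumes scY: "strictly_convex TYPE('b)" and scY': "strictly_convex TYPE('b \<Rightarrow>\<^sub>L real)"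
    and u: "u \<in> proj_space" and M: "finite_measure M"
    and X1: "\<And>w. w \<in> space M \<Longrightarrow> norm (X w) \<le> 1" and Y1: "\<And>w. w \<in> space M \<Longrightarrow> norm (Y w) \<le> 1"
    and mX: "\<And>n. (\<lambda>w. c0_nth (X w) n) \<in> borel_measurable M"
    and mY: "\<And>y. {w \<in> space M. Y w = y} \<in> sets M"
    and int: "\<And>S. has_bochner_integral M (\<lambda>w. blinfun_apply (blinfun_apply S (X w)) (Y w)) (blinfun_apply u S)"
    and tot: "measure M (space M) = pnorm u"
  shows "u \<in> FNA_pi"
proof -
  interpret finite_measure M by fact
  obtain T where T: "norm T \<le> 1" "blinfun_apply u T = pnorm u"
    using norming_operator[OF u] .
  define G where "G = {y :: 'b. norm y \<le> 1 \<and> (\<exists>x. norm x \<le> 1 \<and> T x y = 1)}"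
  have finG: "finite G" unfolding G_def by (rule finite_norming_set[OF scY scY' T(1)])
  have T_le: "T (X w) (Y w) \<le> 1" if "w \<in> space M" for w
  proof -
    have "\<bar>T (X w) (Y w)\<bar> \<le> norm T * (norm (X w) * norm (Y w))" by (rule abs_blinfun_apply2_le)
    also have "\<dots> \<le> 1" using T X1[OF that] Y1[OF that] by (intro mult_le_one) auto
    finally show ?thesis by simp
  qed
  have intT: "integrable M (\<lambda>w. T (X w) (Y w))" and "(\<integral>w. T (X w) (Y w) \<partial>M) = pnorm u"
    using int[of T] T(2) by (auto simp: has_bochner_integral_iff)
  \<comment> \<open>The total mass and the integral of \<open>T (X w) (Y w)\<close> both equal
    \<open>pnorm u\<close>, so the nonnegative difference \<open>1 - T (X w) (Y w)\<close>
    integrates to 0.\<close>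
  then have "(\<integral>w. 1 - T (X w) (Y w) \<partial>M) = 0"
    using tot by simp
  then have "AE w in M. 1 - T (X w) (Y w) = 0"
    using intT T_le by (subst (asm) integral_nonneg_eq_0_iff_AE) auto
  then have AE_G: "AE w in M. Y w \<in> G"
    using AE_space by eventually_elim (use X1 Y1 in \<open>auto simp: G_def\<close>)
  define A where "A y = {w \<in> space M. Y w = y}" for y
  have A: "A y \<in> sets M" for y unfolding A_def by (rule mY)
  \<comment> \<open>The vector \<open>a\<close> is the integral of \<open>X\<close> over the slice
    where \<open>Y\<close> equals \<open>y\<close>; one vector serves all functionals
    \<open>L\<close>.\<close>
  have "\<exists>a. norm a \<le> measure M (A y) \<and> (\<forall>L :: c0 \<Rightarrow> real. bounded_linear L \<longrightarrow>
        has_bochner_integral M (\<lambda>w. indicator (A y) w * L (X w)) (L a))" for y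
    by (rule c0_set_integral[OF M X1 mX A]) blast+
  then obtain a where a: "\<And>y. norm (a y) \<le> measure M (A y)"
    "\<And>y L. bounded_linear L \<Longrightarrow> has_bochner_integral M (\<lambda>w. indicator (A y) w * L (X w)) (L (a y) :: real)"
    by metis
  have u_eq: "u = (\<Sum>y\<in>G. tensor (a y) y)"
  proof (rule blinfun_eqI)
    fix S :: "c0 \<Rightarrow>\<^sub>L ('b \<Rightarrow>\<^sub>L real)"
    have "has_bochner_integral M (\<lambda>w. indicator (A y) w * S (X w) y) (S (a y) y)" for y
      by (rule a(2)) (rule bounded_linear_compose[OF blinfun.bounded_linear_left blinfun.bounded_linear_right])
    then have "has_bochner_integral M (\<lambda>w. \<Sum>y\<in>G. indicator (A y) w * S (X w) y) (\<Sum>y\<in>G. S (a y) y)"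
      by (rule has_bochner_integral_sum)
    \<comment> \<open>Almost every \<open>w\<close> lies in exactly one slice \<open>A y\<close>
      with \<open>y\<close> in \<open>G\<close>, so one term of the sum survives.\<close>
    moreover have "AE w in M. (\<Sum>y\<in>G. indicator (A y) w * S (X w) y) = S (X w) (Y w)"
      using AE_G AE_space
    proof eventually_elim
      case (elim w)
      have "(\<Sum>y\<in>G. indicator (A y) w * S (X w) y) = (\<Sum>y\<in>G. if y = Y w then S (X w) y else 0)"
        using elim by (intro sum.cong) (auto simp: A_def indicator_def)
      also have "\<dots> = S (X w) (Y w)"
        using elim finG by simp
      finally show ?case .
    qed
    moreover note int[of S]
    ultimately have "(\<integral>w. (\<Sum>y\<in>G. indicator (A y) w * S (X w) y) \<partial>M) = (\<integral>w. S (X w) (Y w) \<partial>M)"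
      by (intro integral_cong_AE) (auto simp: has_bochner_integral_iff)
    with \<open>has_bochner_integral M (\<lambda>w. \<Sum>y\<in>G. indicator (A y) w * S (X w) y) _\<close> int[of S]
    have "(\<Sum>y\<in>G. S (a y) y) = blinfun_apply u S"
      by (simp only: has_bochner_integral_iff)
    then show "blinfun_apply u S = blinfun_apply (\<Sum>y\<in>G. tensor (a y) y) S"
      by (simp add: blinfun.sum_left)
  qed
  obtain h where h: "bij_betw h {..<card G} G"
    using ex_bij_betw_nat_finite[OF finG] by (auto simp: atLeast0LessThan)
  have u_sum: "u = (\<Sum>k<card G. tensor (a (h k)) (h k))"
    by (simp add: u_eq sum.reindex_bij_betw[OF h, of "\<lambda>y. tensor (a y) y"])
  have "(\<Sum>k<card G. norm (a (h k)) * norm (h k)) = (\<Sum>y\<in>G. norm (a y) * norm y)"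
    by (rule sum.reindex_bij_betw[OF h])
  \<comment> \<open>The slices are disjoint, so their masses add up to at most the total mass
    \<open>pnorm u\<close>. The reverse inequality holds for every finite representation.\<close>
  also have "\<dots> \<le> (\<Sum>y\<in>G. measure M (A y) * 1)"
    using a(1) by (intro sum_mono mult_mono) (auto simp: G_def)
  also have "\<dots> = measure M (\<Union>y\<in>G. A y)"
    by (subst finite_measure_finite_Union[OF finG]) (use A in \<open>auto simp: disjoint_family_on_def A_def\<close>)
  also have "\<dots> \<le> pnorm u"
    unfolding tot[symmetric] by (rule bounded_measure)
  finally have "(\<Sum>k<card G. norm (a (h k)) * norm (h k)) = pnorm u"
    using pnorm_sum_le[of "\<lambda>k. a (h k)" h "card G"] u_sum by simp
  with u u_sum show ?thesis
    unfolding FNA_pi_def mem_Collect_eq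
    by (intro conjI exI[of _ "card G"] exI[of _ "\<lambda>k. a (h k)"] exI[of _ h])
qed

section \<open>Norm-attaining tensors\<close>

lemma NA_pi_subset_FNA_pi:
  assumes scY: "strictly_convex TYPE('b::real_normed_vector)"
    and scY': "strictly_convex TYPE('b \<Rightarrow>\<^sub>L real)"
  shows "(NA_pi :: (c0, 'b) ptensor set) \<subseteq> FNA_pi"
proof
  fix u :: "(c0, 'b) ptensor" assume "u \<in> NA_pi"
  then obtain l :: "nat \<Rightarrow> real" and x y where u: "u \<in> proj_space"
    and l0: "\<And>n. l n \<ge> 0" and xy: "\<And>n. norm (x n) \<le> 1" "\<And>n. norm (y n) \<le> 1"
    and suml: "summable l" and us: "(\<lambda>n. l n *\<^sub>R tensor (x n) (y n)) sums u" and tot: "suminf l = pnorm u"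
    unfolding NA_pi_def by auto
  \<comment> \<open>Mass \<open>l n\<close> at the index \<open>n\<close>: integrals over
    \<open>M\<close> are the weighted series, and the total mass is \<open>suminf l\<close>.\<close>
  define M where "M = density (count_space UNIV) (\<lambda>n. ennreal (l n))"
  have [simp]: "space M = UNIV" "sets M = UNIV" by (simp_all add: M_def)
  have eM: "emeasure M (space M) = ennreal (suminf l)"
    using suminf_ennreal2[OF l0 suml] by (simp add: M_def emeasure_density nn_integral_count_space_nat)
  have "suminf l \<ge> 0" using suml l0 by (rule suminf_nonneg)
  show "u \<in> FNA_pi"
  proof (rule FNA_pi_if_weak_integral[OF scY scY' u, of M x y])
    show "finite_measure M" by (rule finite_measureI) (simp only: eM, simp)
    show "measure M (space M) = pnorm u"
      using \<open>suminf l \<ge> 0\<close> unfolding measure_def eM by (simp add: tot)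
    fix S :: "c0 \<Rightarrow>\<^sub>L ('b \<Rightarrow>\<^sub>L real)"
    have s: "(\<lambda>n. l n * S (x n) (y n)) sums blinfun_apply u S"
      using bounded_linear.sums[OF blinfun.bounded_linear_left us, of S] by (simp add: blinfun.scaleR_left)
    have "\<bar>S (x n) (y n)\<bar> \<le> norm S" for n
    proof -
      have "\<bar>S (x n) (y n)\<bar> \<le> norm S * (norm (x n) * norm (y n))" by (rule abs_blinfun_apply2_le)
      also have "\<dots> \<le> norm S * 1" using xy[of n] by (intro mult_left_mono mult_le_one) auto
      finally show ?thesis by simp
    qed
    then have "norm (l n * S (x n) (y n)) \<le> l n * norm S" for n
      using l0[of n] by (simp add: abs_mult mult_left_mono)
    then have "summable (\<lambda>n. norm (l n * S (x n) (y n)))"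
      by (intro summable_comparison_test'[OF summable_mult2[OF suml, of "norm S"]]) simp
    then have i: "integrable (count_space UNIV) (\<lambda>n. l n * S (x n) (y n))"
      by (simp add: integrable_count_space_nat_iff)
    have "has_bochner_integral (count_space UNIV) (\<lambda>n. l n *\<^sub>R S (x n) (y n)) (blinfun_apply u S)"
      using i integral_count_space_nat[OF i] sums_unique[OF s] by (simp add: has_bochner_integral_iff)
    then show "has_bochner_integral M (\<lambda>n. S (x n) (y n)) (blinfun_apply u S)"
      unfolding M_def by (intro has_bochner_integral_density) (auto simp: l0)
  qed (use xy in \<open>simp_all add: measurable_def\<close>)
qed

text \<open>Evaluation at \<open>S\<close> is continuous for \<open>pnorm\<close>, so it turns the
  integral with respect to \<open>pnorm\<close> into a scalar Bochner integral: the approximating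
  simple functions are composed with this evaluation.\<close>

lemma INA_pi_subset_FNA_pi:
  assumes scY: "strictly_convex TYPE('b::real_normed_vector)"
    and scY': "strictly_convex TYPE('b \<Rightarrow>\<^sub>L real)"
  shows "(INA_pi :: (c0, 'b) ptensor set) \<subseteq> FNA_pi"
proof
  fix u :: "(c0, 'b) ptensor" assume "u \<in> INA_pi"
  then obtain M :: "(c0 \<times> 'b) measure" where u: "u \<in> proj_space"
    and spM: "space M = cball 0 1 \<times> cball 0 1"
    and setsM: "sets M = sets (restrict_space borel (cball 0 1 \<times> cball 0 1))"
    and finM: "finite_measure M" and int: "has_pbochner_integral M (\<lambda>(x, y). tensor x y) u"
    and tot: "measure M (space M) = pnorm u"
    unfolding INA_pi_def by auto
  have meas: "f \<in> borel_measurable M" if "continuous_on UNIV f" for f :: "c0 \<times> 'b \<Rightarrow> real"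
    using measurable_restrict_space1[OF borel_measurable_continuous_onI[OF that]]
    by (simp add: measurable_cong_sets[OF setsM refl])
  let ?f = "\<lambda>(x :: c0, y :: 'b). tensor x y"
  have fM: "?f ` space M \<subseteq> proj_space"
    using int by (simp only: has_pbochner_integral_def)
  from int obtain s where "\<forall>i. Bochner_Integration.simple_bochner_integrable M (s i) \<and> s i ` space M \<subseteq> proj_space \<and>
      (\<lambda>z. pnorm (?f z - s i z)) \<in> borel_measurable M"
    and lim: "(\<lambda>i. \<integral>\<^sup>+ z. ennreal (pnorm (?f z - s i z)) \<partial>M) \<longlonglongrightarrow> 0"
      "(\<lambda>i. pnorm (Bochner_Integration.simple_bochner_integral M (s i) - u)) \<longlonglongrightarrow> 0"
    unfolding has_pbochner_integral_def by blast
  then have s: "\<And>i. Bochner_Integration.simple_bochner_integrable M (s i)" "\<And>i. s i ` space M \<subseteq> proj_space"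
      "\<And>i. (\<lambda>z. pnorm (?f z - s i z)) \<in> borel_measurable M"
    by simp_all
  show "u \<in> FNA_pi"
  proof (rule FNA_pi_if_weak_integral[OF scY scY' u finM, of fst snd])
    show "measure M (space M) = pnorm u" by (rule tot)
    show "(\<lambda>w. c0_nth (fst w) n) \<in> borel_measurable M" for n
      by (intro meas bounded_linear.continuous_on[OF bounded_linear_c0_nth] continuous_intros)
    show "{w \<in> space M. snd w = y} \<in> sets M" for y
    proof -
      \<comment> \<open>Slices over a single \<open>y\<close> are closed, hence Borel; later only
        finitely many of them matter.\<close>
      have "closed {w :: c0 \<times> 'b. snd w = y}"
        by (intro closed_Collect_eq continuous_intros)
      then have "{w :: c0 \<times> 'b. snd w = y} \<in> sets borel" by (rule borel_closed)
      then have "space M \<inter> {w. snd w = y} \<in> sets M"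
        unfolding setsM sets_restrict_space spM by blast
      then show ?thesis by (simp add: Int_def)
    qed
    fix S :: "c0 \<Rightarrow>\<^sub>L ('b \<Rightarrow>\<^sub>L real)"
    show "has_bochner_integral M (\<lambda>w. S (fst w) (snd w)) (blinfun_apply u S)"
    proof (rule has_bochner_integral.intros)
      show "(\<lambda>w. S (fst w) (snd w)) \<in> borel_measurable M"
        by (intro meas continuous_intros)
      show si: "Bochner_Integration.simple_bochner_integrable M (\<lambda>w. blinfun_apply (s i w) S)" for i
        using simple_bochner_integrable_compose2[of "\<lambda>v _. blinfun_apply v S", OF _ s(1) s(1)]
        by simp
      have "(\<lambda>i. ennreal (norm S) * (\<integral>\<^sup>+ z. ennreal (pnorm (?f z - s i z)) \<partial>M)) \<longlonglongrightarrow> ennreal (norm S) * 0"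
        by (intro ennreal_tendsto_cmult lim) simp
      then have upper: "(\<lambda>i. ennreal (norm S) * (\<integral>\<^sup>+ z. ennreal (pnorm (?f z - s i z)) \<partial>M)) \<longlonglongrightarrow> 0"
        by simp
      have le: "(\<integral>\<^sup>+ w. ennreal (norm (S (fst w) (snd w) - blinfun_apply (s i w) S)) \<partial>M)
          \<le> ennreal (norm S) * (\<integral>\<^sup>+ z. ennreal (pnorm (?f z - s i z)) \<partial>M)" for i
      proof -
        have "(\<integral>\<^sup>+ w. ennreal (norm (S (fst w) (snd w) - blinfun_apply (s i w) S)) \<partial>M)
            \<le> (\<integral>\<^sup>+ w. ennreal (norm S) * ennreal (pnorm (?f w - s i w)) \<partial>M)"
        proof (rule nn_integral_mono)
          fix w assume w: "w \<in> space M"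
          \<comment> \<open>The estimate by \<open>pnorm\<close> is available on
            \<open>proj_space\<close> only; both terms lie in this subspace for \<open>w\<close> in
            \<open>space M\<close>.\<close>
          have d: "?f w - s i w \<in> proj_space"
            using fM s(2)[of i] w by (intro subspace_diff[OF subspace_proj_space]) auto
          have "norm (S (fst w) (snd w) - blinfun_apply (s i w) S) = \<bar>blinfun_apply (?f w - s i w) S\<bar>"
            by (simp add: blinfun.diff_left split_beta)
          also have "\<dots> \<le> norm S * pnorm (?f w - s i w)"
            by (rule abs_apply_le_pnorm[OF d])
          finally show "ennreal (norm (S (fst w) (snd w) - blinfun_apply (s i w) S))
              \<le> ennreal (norm S) * ennreal (pnorm (?f w - s i w))"
            using pnorm_nonneg[OF d] by (simp add: ennreal_leI flip: ennreal_mult)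
        qed
        also have "\<dots> = ennreal (norm S) * (\<integral>\<^sup>+ z. ennreal (pnorm (?f z - s i z)) \<partial>M)"
          by (rule nn_integral_cmult) (use s(3) in measurable)
        finally show ?thesis .
      qed
      show "(\<lambda>i. \<integral>\<^sup>+ w. ennreal (norm (S (fst w) (snd w) - blinfun_apply (s i w) S)) \<partial>M) \<longlonglongrightarrow> 0"
        by (rule tendsto_sandwich[OF _ _ tendsto_const upper]; rule always_eventually, rule allI)
          (rule zero_le, rule le)
      \<comment> \<open>The simple integral is a finite combination of values of \<open>s i\<close>
        on \<open>space M\<close>, so it stays in the subspace.\<close>
      have in_proj: "Bochner_Integration.simple_bochner_integral M (s i) - u \<in> proj_space" for i
        unfolding simple_bochner_integral_def using s(2)[of i] u
        by (intro subspace_diff[OF subspace_proj_space] subspace_sum[OF subspace_proj_space]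
            subspace_scale[OF subspace_proj_space]) auto
      have eq: "Bochner_Integration.simple_bochner_integral M (\<lambda>w. blinfun_apply (s i w) S) =
          blinfun_apply (Bochner_Integration.simple_bochner_integral M (s i)) S" for i
        by (rule simple_bochner_integral_linear[OF bounded_linear.linear[OF blinfun.bounded_linear_left] s(1)])
      have "(\<lambda>i. norm S * pnorm (Bochner_Integration.simple_bochner_integral M (s i) - u)) \<longlonglongrightarrow> 0"
        by (rule tendsto_mult_right_zero[OF lim(2)])
      then have "(\<lambda>i. blinfun_apply (Bochner_Integration.simple_bochner_integral M (s i)) S - blinfun_apply u S) \<longlonglongrightarrow> 0"
        by (rule Lim_null_comparison[rotated])
          (use abs_apply_le_pnorm[OF in_proj, of _ S] in \<open>simp add: blinfun.diff_left\<close>)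
      then show "(\<lambda>i. Bochner_Integration.simple_bochner_integral M (\<lambda>w. blinfun_apply (s i w) S)) \<longlonglongrightarrow> blinfun_apply u S"
        unfolding eq by (rule LIM_zero_cancel)
    qed
  qed (auto simp: spM)
qed

section \<open>From finite representations to series and measures\<close>

lemma norm_scaleR_sgn: "norm x *\<^sub>R sgn x = (x :: 'a::real_normed_vector)"
  by (cases "x = 0") (simp_all add: sgn_div_norm)

text \<open>Moves the norms into the weight and the factors into the unit ball; since
  \<open>sgn 0 = 0\<close>, zero factors are covered.\<close>

lemma tensor_sgn: "(norm x * norm y) *\<^sub>R tensor (sgn x) (sgn y) = tensor x y"
proof -
  have "tensor (norm x *\<^sub>R sgn x) (norm y *\<^sub>R sgn y) = tensor x y"
    by (simp only: norm_scaleR_sgn)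
  then show ?thesis by (simp add: tensor.scaleR_left tensor.scaleR_right mult.commute)
qed

lemma norm_sgn_le: "norm (sgn x) \<le> 1"
  by (simp add: norm_sgn)

lemma FNA_pi_subset_NA_pi: "(FNA_pi :: ('a::real_normed_vector, 'b::real_normed_vector) ptensor set) \<subseteq> NA_pi"
proof
  fix u :: "('a, 'b) ptensor" assume "u \<in> FNA_pi"
  then obtain n :: nat and x y where u: "u \<in> proj_space" "u = (\<Sum>k<n. tensor (x k) (y k))"
    "(\<Sum>k<n. norm (x k) * norm (y k)) = pnorm u"
    unfolding FNA_pi_def by blast
  define l where "l k = (if k < n then norm (x k) * norm (y k) else 0)" for k
  have "l sums (\<Sum>k<n. l k)" by (rule sums_finite) (auto simp: l_def)
  then have l: "l sums pnorm u" using u(3) by (simp add: l_def)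
  have "(\<lambda>k. l k *\<^sub>R tensor (sgn (x k)) (sgn (y k))) sums (\<Sum>k<n. l k *\<^sub>R tensor (sgn (x k)) (sgn (y k)))"
    by (rule sums_finite) (auto simp: l_def)
  then have us: "(\<lambda>k. l k *\<^sub>R tensor (sgn (x k)) (sgn (y k))) sums u"
    by (simp add: l_def tensor_sgn flip: u(2))
  have "\<forall>k. l k \<ge> 0 \<and> norm (sgn (x k)) \<le> 1 \<and> norm (sgn (y k)) \<le> 1"
    by (simp add: l_def norm_sgn_le)
  with u(1) l us show "u \<in> NA_pi"
    unfolding NA_pi_def mem_Collect_eq
    by (intro conjI exI[of _ l] exI[of _ "\<lambda>k. sgn (x k)"] exI[of _ "\<lambda>k. sgn (y k)"]) (auto simp: sums_iff)
qed

lemma FNA_pi_subset_INA_pi: "(FNA_pi :: ('a::real_normed_vector, 'b::real_normed_vector) ptensor set) \<subseteq> INA_pi"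
proof
  fix u :: "('a, 'b) ptensor" assume "u \<in> FNA_pi"
  then obtain n :: nat and x y where u: "u \<in> proj_space" "u = (\<Sum>k<n. tensor (x k) (y k))"
    "(\<Sum>k<n. norm (x k) * norm (y k)) = pnorm u"
    unfolding FNA_pi_def by blast
  define l where "l k = norm (x k) * norm (y k)" for k
  have l0: "l k \<ge> 0" for k by (simp add: l_def)
  define p where "p k = (sgn (x k), sgn (y k))" for k
  define B :: "('a \<times> 'b) set" where "B = cball 0 1 \<times> cball 0 1"
  define N where "N = restrict_space borel B"
  \<comment> \<open>Weights are placed on the indices and transported by \<open>p\<close>, so
    coinciding points \<open>p k\<close> need no separate treatment.\<close>
  define Q where "Q = point_measure {..<n} (\<lambda>k. ennreal (l k))"
  define M where "M = distr Q N p"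
  have spN: "space N = B" by (simp add: N_def space_restrict_space)
  then have spM: "space M = B" by (simp add: M_def)
  have setsM: "sets M = sets N" by (simp add: M_def)
  have pB: "p k \<in> B" for k by (simp add: p_def B_def norm_sgn_le)
  have p: "p \<in> measurable Q N" by (auto simp: Q_def spN pB)
  have finQ: "finite_measure Q"
    by (rule finite_measureI) (simp add: Q_def space_point_measure emeasure_point_measure_finite l0)
  have finM: "finite_measure M"
    unfolding M_def by (rule finite_measure.finite_measure_distr[OF finQ p])
  have "emeasure M (space M) = ennreal (\<Sum>k<n. l k)"
  proof -
    have "emeasure M (space M) = emeasure Q (p -` B \<inter> space Q)"
      unfolding spM unfolding M_def using p by (subst emeasure_distr) (auto simp flip: spN)
    also have "p -` B \<inter> space Q = {..<n}" using pB by (auto simp: Q_def space_point_measure)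
    also have "emeasure Q {..<n} = ennreal (\<Sum>k<n. l k)"
      by (simp add: Q_def emeasure_point_measure_finite l0)
    finally show ?thesis .
  qed
  then have tot: "measure M (space M) = pnorm u"
    using u(3) pnorm_nonneg[OF u(1)] by (simp add: measure_def l_def)
  let ?f = "\<lambda>(x :: 'a, y :: 'b). tensor x y"
  have meas: "f \<in> measurable M borel" if "continuous_on UNIV f" for f :: "'a \<times> 'b \<Rightarrow> 'c::topological_space"
    using measurable_restrict_space1[OF borel_measurable_continuous_onI[OF that]]
    by (simp add: measurable_cong_sets[OF setsM refl] N_def)
  define Z where "Z = p ` {..<n}"
  have finset: "K \<in> sets M" if "finite K" "K \<subseteq> B" for K
  proof -
    have "K = B \<inter> K" using that by blast
    moreover have "K \<in> sets borel" using that by (intro borel_closed finite_imp_closed)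
    ultimately show ?thesis unfolding setsM N_def sets_restrict_space by blast
  qed
  have Z: "finite Z" "Z \<subseteq> B" using pB by (auto simp: Z_def)
  \<comment> \<open>\<open>M\<close> is concentrated on the finite set \<open>Z\<close>, so the
    tensor map agrees almost everywhere with this simple function, and the constant sequence
    \<open>s\<close> serves as the approximation.\<close>
  define s where "s z = (if z \<in> Z then ?f z else 0)" for z
  have simple: "simple_function M s"
    unfolding simple_function_def
  proof (intro conjI ballI)
    have "s ` space M \<subseteq> insert 0 (?f ` Z)" by (auto simp: s_def)
    then show "finite (s ` space M)" by (rule finite_subset) (use Z in simp)
    fix v
    \<comment> \<open>A fibre is a finite set, together with the complement of \<open>Z\<close> when
      the value is 0.\<close>
    have eq: "s -` {v} \<inter> space M = {z \<in> Z. ?f z = v} \<union> (if v = 0 then space M - Z else {})"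
      using Z by (auto simp: s_def spM split: if_splits)
    have "{z \<in> Z. ?f z = v} \<in> sets M" by (rule finset) (use Z in auto)
    then show "s -` {v} \<inter> space M \<in> sets M"
      unfolding eq using finset[OF Z] by auto
  qed
  interpret M: finite_measure M by (rule finM)
  have sbi: "Bochner_Integration.simple_bochner_integrable M s"
    using simple by (rule simple_bochner_integrable.intros) simp
  \<comment> \<open>The explicit form shows measurability: it is 0 on the finite set
    \<open>Z\<close> and a continuous function of \<open>z\<close> elsewhere.\<close>
  have pf: "pnorm (?f z - s z) = (if z \<in> Z then 0 else norm (fst z) * norm (snd z))" for z
    by (simp add: s_def pnorm_0 pnorm_tensor split_beta)
  have pf_meas: "(\<lambda>z. pnorm (?f z - s z)) \<in> borel_measurable M"
    unfolding pf
  proof (rule measurable_If_set)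
    show "(\<lambda>z. norm (fst z) * norm (snd z)) \<in> borel_measurable M"
      by (intro meas continuous_intros)
    show "Z \<inter> space M \<in> sets M" using finset[OF Z] by (intro sets.Int) auto
  qed simp
  have "(\<integral>\<^sup>+ z. ennreal (pnorm (?f z - s z)) \<partial>M) = (\<integral>\<^sup>+ k. ennreal (pnorm (?f (p k) - s (p k))) \<partial>Q)"
    unfolding M_def
    by (rule nn_integral_distr[OF p measurable_compose[OF pf_meas[unfolded M_def] measurable_ennreal]])
  also have "\<dots> = (\<Sum>k<n. ennreal (l k) * ennreal (pnorm (?f (p k) - s (p k))))"
    unfolding Q_def by (rule nn_integral_point_measure_finite) simp
  also have "\<dots> = 0"
    unfolding pf by (intro sum.neutral) (auto simp: Z_def)
  finally have nn0: "(\<integral>\<^sup>+ z. ennreal (pnorm (?f z - s z)) \<partial>M) = 0" .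
  have "Bochner_Integration.simple_bochner_integral M s = u"
  proof (rule blinfun_eqI)
    fix S :: "'a \<Rightarrow>\<^sub>L ('b \<Rightarrow>\<^sub>L real)"
    have si: "Bochner_Integration.simple_bochner_integrable M (\<lambda>w. blinfun_apply (s w) S)"
      using simple_bochner_integrable_compose2[of "\<lambda>v _. blinfun_apply v S", OF _ sbi sbi] by simp
    have "blinfun_apply (Bochner_Integration.simple_bochner_integral M s) S = Bochner_Integration.simple_bochner_integral M (\<lambda>w. blinfun_apply (s w) S)"
      by (rule simple_bochner_integral_linear[OF bounded_linear.linear[OF blinfun.bounded_linear_left] sbi, symmetric])
    also have "\<dots> = (\<integral>w. blinfun_apply (s w) S \<partial>M)"
      by (rule simple_bochner_integrable_eq_integral[OF si])
    also have "\<dots> = (\<integral>k. blinfun_apply (s (p k)) S \<partial>Q)"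
      unfolding M_def
    proof (rule integral_distr[OF p])
      show "(\<lambda>w. blinfun_apply (s w) S) \<in> borel_measurable N"
        using borel_measurable_simple_function[of M "\<lambda>w. blinfun_apply (s w) S"] si
        by (simp add: simple_bochner_integrable.simps measurable_cong_sets[OF setsM refl])
    qed
    also have "\<dots> = (\<Sum>k<n. l k *\<^sub>R blinfun_apply (s (p k)) S)"
      unfolding Q_def by (rule lebesgue_integral_point_measure_finite) (auto simp: l0)
    also have "\<dots> = (\<Sum>k<n. blinfun_apply (l k *\<^sub>R tensor (sgn (x k)) (sgn (y k))) S)"
      by (intro sum.cong) (auto simp: s_def Z_def p_def blinfun.scaleR_left)
    also have "\<dots> = blinfun_apply u S"
      unfolding l_def tensor_sgn by (simp add: u(2) blinfun.sum_left)
    finally show "blinfun_apply (Bochner_Integration.simple_bochner_integral M s) S = blinfun_apply u S" .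
  qed
  moreover have "?f \<in> borel_measurable M"
    unfolding split_beta by (intro meas tensor.continuous_on continuous_intros)
  ultimately have "has_pbochner_integral M ?f u"
    unfolding has_pbochner_integral_def
    using u(1) sbi pf_meas nn0
    by (intro conjI exI[of _ "\<lambda>_. s"])
      (auto simp: pnorm_0 tensor_in_proj_space zero_in_proj_space s_def)
  with u(1) spM setsM finM tot show "u \<in> INA_pi"
    unfolding INA_pi_def mem_Collect_eq N_def B_def by blast
qed

section \<open>A tensor outside the algebraic tensor product\<close>

text \<open>Independent vectors \<open>f n\<close> are placed in different coordinates of c0, with
  geometric weights for convergence. A finite sum of elementary tensors has all its coordinates in
  one finite-dimensional subspace, which cannot contain every \<open>f n\<close>.\<close>

lemma alg_tensor_neq_proj_space:
  assumes inf: "\<not> (\<exists>B :: 'b::real_normed_vector set. finite B \<and> span B = UNIV)"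
  shows "\<exists>u :: (c0, 'b) ptensor. u \<in> proj_space \<and> u \<notin> alg_tensor"
proof -
  obtain B :: "'b set" where B: "independent B" "UNIV \<subseteq> span B"
    using real_vector.maximal_independent_subset by metis
  then have "infinite B" using inf by blast
  then obtain f :: "nat \<Rightarrow> 'b" where f: "inj f" "range f \<subseteq> B"
    using infinite_countable_subset by blast
  have indep: "independent (range f)"
    using B(1) f(2) real_vector.independent_mono by blast
  define x where "x n = (1/2::real) ^ n *\<^sub>R c0_unit n" for n
  define y where "y n = sgn (f n)" for n
  have le: "norm (norm (x n) * norm (y n)) \<le> (1/2) ^ n" for n
  proof -
    have "norm (x n) * norm (y n) \<le> (1/2) ^ n * 1"
      unfolding x_def y_def using norm_c0_unit_le[of n]
      by (intro mult_mono) (auto simp: norm_sgn_le mult_left_le)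
    then show ?thesis by simp
  qed
  have sm: "summable (\<lambda>n. norm (x n) * norm (y n))"
    by (rule summable_comparison_test'[OF _ le]) (simp add: summable_geometric)
  have "summable (\<lambda>n. tensor (x n) (y n))"
    by (rule summable_comparison_test'[OF sm norm_tensor_le])
  then obtain u where us: "(\<lambda>n. tensor (x n) (y n)) sums u" by (auto simp: summable_def)
  with sm have rep: "proj_rep u x y" by (simp add: proj_rep_def)
  moreover have "u \<notin> alg_tensor"
  proof
    assume "u \<in> alg_tensor"
    then obtain m :: nat and a b where u: "u = (\<Sum>k<m. tensor (a k) (b k))"
      unfolding alg_tensor_def by blast
    have "f n \<in> span (b ` {..<m})" for n
    proof -
      \<comment> \<open>The difference of the \<open>n\<close>-th coordinates computed from the
        series and from the finite sum. The operator \<open>T\<close> pairs this coordinate with a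
        functional \<open>g\<close> norming \<open>z\<close>, so \<open>g z = 0\<close> gives
        \<open>z = 0\<close>.\<close>
      define z where "z = (1/2::real) ^ n *\<^sub>R y n - (\<Sum>k<m. c0_nth (a k) n *\<^sub>R b k)"
      obtain g :: "'b \<Rightarrow>\<^sub>L real" where g: "g z = norm z" by (rule norming_functional)
      define T where "T = blinfun_scaleR_left g o\<^sub>L Blinfun (\<lambda>x. c0_nth x n)"
      have T: "blinfun_apply (T v) w = c0_nth v n * g w" for v w
        by (simp add: T_def blinfun.scaleR_left bounded_linear_Blinfun_apply[OF bounded_linear_c0_nth])
      have "(\<lambda>k. T (x k) (y k)) sums blinfun_apply u T"
        using rep by (simp add: proj_rep_iff)
      moreover have "(\<lambda>k. T (x k) (y k)) sums (\<Sum>k\<in>{n}. T (x k) (y k))"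
        by (rule sums_finite) (auto simp: T x_def)
      ultimately have "blinfun_apply u T = (1/2) ^ n * g (y n)"
        using sums_unique2 by (fastforce simp: T x_def)
      moreover have "blinfun_apply u T = (\<Sum>k<m. c0_nth (a k) n * g (b k))"
        by (simp add: u blinfun.sum_left T)
      ultimately have "g z = 0"
        by (simp add: z_def blinfun.diff_right blinfun.sum_right blinfun.scaleR_right)
      then have "(1/2::real) ^ n *\<^sub>R y n = (\<Sum>k<m. c0_nth (a k) n *\<^sub>R b k)"
        using g by (simp add: z_def)
      also have "\<dots> \<in> span (b ` {..<m})"
        by (intro span_sum span_scale span_base) auto
      \<comment> \<open>This factor undoes the weight and the normalisation.\<close>
      finally have "(norm (f n) * 2 ^ n) *\<^sub>R ((1/2::real) ^ n *\<^sub>R y n) \<in> span (b ` {..<m})"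
        by (rule span_scale)
      also have "(norm (f n) * 2 ^ n) *\<^sub>R ((1/2::real) ^ n *\<^sub>R y n) = f n"
        by (simp add: y_def norm_scaleR_sgn power_divide)
      finally show ?thesis .
    qed
    then have "finite (range f)"
      using real_vector.independent_span_bound[OF _ indep, of "b ` {..<m}"] by blast
    then show False using f(1) finite_imageD infinite_UNIV_nat by blast
  qed
  ultimately show ?thesis unfolding proj_space_def by blast
qed

theorem theorem4p2:
  assumes "strictly_convex TYPE('b::banach)"
    and "strictly_convex TYPE('b \<Rightarrow>\<^sub>L real)"
  shows "(INA_pi :: (c0, 'b) ptensor set) = NA_pi \<and> (NA_pi :: (c0, 'b) ptensor set) = FNA_pi \<and>
         (FNA_pi :: (c0, 'b) ptensor set) \<subseteq> alg_tensor \<and>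
         (\<not> (\<exists>B :: 'b set. finite B \<and> span B = UNIV) \<longrightarrow>
            (INA_pi :: (c0, 'b) ptensor set) \<noteq> proj_space)"
proof -
  have "(NA_pi :: (c0, 'b) ptensor set) = FNA_pi"
    by (rule antisym[OF NA_pi_subset_FNA_pi[OF assms] FNA_pi_subset_NA_pi])
  moreover have INA: "(INA_pi :: (c0, 'b) ptensor set) = FNA_pi"
    by (rule antisym[OF INA_pi_subset_FNA_pi[OF assms] FNA_pi_subset_INA_pi])
  moreover have alg: "(FNA_pi :: (c0, 'b) ptensor set) \<subseteq> alg_tensor"
    unfolding FNA_pi_def alg_tensor_def by blast
  moreover have "(INA_pi :: (c0, 'b) ptensor set) \<noteq> proj_space"
    if "\<not> (\<exists>B :: 'b set. finite B \<and> span B = UNIV)"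
    using alg_tensor_neq_proj_space[OF that] alg unfolding INA by blast
  ultimately show ?thesis by simp
qed

end
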